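(* Let $\mu\ge3$ be an integer, $\varpi=2\cos(\pi/\mu)$, $w$ an even integer and $r\ge0$ an integer. Consider a Hecke automorphic linear differential equation $$\mathsf H_{\mathbf B}[y]:\quad \partial^{r+1}_{w-r}y+B_4\,\partial^{r-1}_{w-r}y+\cdots+B_{2r+2}\,y=0,\qquad B_{2j}\in\mathcal M_{2j}(\mathfrak H(\varpi)),\ 2\le j\le r+1,$$ and let $\vec Y=(y_0,\dots,y_r)^{\mathrm T}$ be a fundamental solution vector. Suppose that the vanishing orders $\Lambda_{\mathsf H}=(\lambda_0,\dots,\lambda_r)$ of $\mathsf H_{\mathbf B}$ are integers satisfying $\lambda_0\ge\lambda_1\ge\cdots\ge\lambda_r\ge0$. Then $$\mathcal W_{\vec Y}=c\,\Delta_{\mu}^{\frac{w(r+1)}{\delta_\mu}}$$ for some complex constant $c\ne0$.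
   Context: $\mathbb H$ is the upper half plane. $\mathfrak H(\varpi)\subset \mathrm{PSL}_2(\mathbb R)$ is the Hecke triangle group of signature $(2,\mu,\infty)$, generated by $Sz=-1/z$ and $Tz=z+\varpi$. Put $q=e^{2\pi i z/\varpi}$ and $\theta=q\frac{d}{dq}=\frac{\varpi}{2\pi i}\frac{d}{dz}$. For even $v$, $\mathcal M_v(\mathfrak H(\varpi))$ is the space of automorphic forms of weight $v$: holomorphic $f:\mathbb H\to\mathbb C$ with $f\big(\frac{az+b}{cz+d}\big)=(cz+d)^v f(z)$ for all $\frac{az+b}{cz+d}\in\mathfrak H(\varpi)$ and with an expansion $\sum_{n\ge0}a_nq^n$. $E_2$ is the normalized quasiautomorphic form of weight 2: holomorphic on $\mathbb H$, with an expansion $1+\sum_{n\ge1}e_nq^n$, and satisfying $\frac{E_2(\gamma z)}{(cz+d)^2}=E_2(z)+C\frac{c}{cz+d}$ for all $\gamma z=\frac{az+b}{cz+d}\in\mathfrak H(\varpi)$, with a constant $C$. The Ramanujan–Serre operator is $\partial_v f=\theta f-\frac{v(\mu-2)}{4\mu}E_2f$, with iterates $\partial^0_vf=f$, $\partial^{k+1}_vf=\partial_{v+2k}(\partial^k_vf)$. A fundamental solution vector is a vector whose entries form a basis of the space of solutions holomorphic on $\mathbb H$. Its Wronskian is $\mathcal W_{\vec Y}=\det\big(\vec Y\ \ \partial_{w-r}\vec Y\ \cdots\ \partial^r_{w-r}\vec Y\big)$, with operators applied entrywise. Writing the equation as $\theta^{r+1}y+\sum_{j=0}^{r}A_j\theta^jy=0$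 with $A_j=\sum_{n\ge0}A_{j,n}q^n$, its vanishing orders $\Lambda_{\mathsf H}$ are the roots, with multiplicity, of the indicial polynomial $\lambda^{r+1}+\sum_{j=0}^rA_{j,0}\lambda^j$. $J$ is the Hecke hauptmodul of $\mathfrak H(\varpi)$: the $\mathfrak H(\varpi)$-invariant holomorphic function on $\mathbb H$ mapping the interior of the hyperbolic triangle with vertices $i$, $-e^{-\pi i/\mu}$, $i\infty$ conformally onto $\mathbb H$, with $J(i)=1$, $J(-e^{-\pi i/\mu})=0$, $J(i\infty)=\infty$. Put $\delta_\mu=2\,\mathrm{lcm}(2,\mu)$. The Hecke automorphic discriminant is $$\Delta_\mu=\Big(\frac{\theta J}{J(J-1)}\Big)^{\mu}J\,(J-1)^{\mu/2}\ (\mu\text{ even}),\qquad \Delta_\mu=\Big(\frac{\theta J}{J(J-1)}\Big)^{2\mu}J^2(J-1)^{\mu}\ (\mu\text{ odd});$$ it is an automorphic form of weight $\delta_\mu$. If the exponent $w(r+1)/\delta_\mu$ is not an integer, the power of $\Delta_\mu$ denotes a holomorphic branch on $\mathbb H$. *)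

theory Defs
  imports
    "HOL-Complex_Analysis.Complex_Analysis"
    "Jordan_Normal_Form.Determinant"
begin

section \<open>Hecke triangle groups\<close>

definition upper_half_plane :: "complex set" where
  "upper_half_plane = {z. Im z > 0}"

definition hecke_width :: "nat \<Rightarrow> real" where
  "hecke_width \<mu> = 2 * cos (pi / real \<mu>)"

text \<open>
  The subgroup of \<open>SL\<^sub>2(\<real>)\<close> generated by the matrices of \<open>S\<close> and \<open>T\<close>. Since \<open>S\<^sup>2 = -I\<close>, it is
  the full preimage of the Hecke triangle group in \<open>PSL\<^sub>2(\<real>)\<close>. The sign of a representing
  matrix plays no role below, where only even weights and the ratio \<open>c / (c z + d)\<close> occur.
\<close>

inductive_set hecke_group :: "nat \<Rightarrow> (real ^ 2 ^ 2) set" for \<mu> :: nat where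
  one:  "Finite_Cartesian_Product.mat 1 \<in> hecke_group \<mu>"
| S:    "vector [vector [0, -1], vector [1, 0]] \<in> hecke_group \<mu>"
| T:    "vector [vector [1, hecke_width \<mu>], vector [0, 1]] \<in> hecke_group \<mu>"
| mult: "A \<in> hecke_group \<mu> \<Longrightarrow> B \<in> hecke_group \<mu> \<Longrightarrow> A ** B \<in> hecke_group \<mu>"
| inv:  "A \<in> hecke_group \<mu> \<Longrightarrow> matrix_inv A \<in> hecke_group \<mu>"

definition aut_denom :: "real ^ 2 ^ 2 \<Rightarrow> complex \<Rightarrow> complex" where
  "aut_denom A z = of_real (A $ 2 $ 1) * z + of_real (A $ 2 $ 2)"

definition moebius_act :: "real ^ 2 ^ 2 \<Rightarrow> complex \<Rightarrow> complex" where
  "moebius_act A z = (of_real (A $ 1 $ 1) * z + of_real (A $ 1 $ 2)) / aut_denom A z"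


section \<open>Automorphic forms, \<open>E\<^sub>2\<close>, and the Ramanujan--Serre operator\<close>

definition hecke_q :: "nat \<Rightarrow> complex \<Rightarrow> complex" where
  "hecke_q \<mu> z = exp (2 * of_real pi * \<i> * z / of_real (hecke_width \<mu>))"

definition has_q_expansion :: "nat \<Rightarrow> (complex \<Rightarrow> complex) \<Rightarrow> (nat \<Rightarrow> complex) \<Rightarrow> bool" where
  "has_q_expansion \<mu> f a \<longleftrightarrow>
     (\<forall>z\<in>upper_half_plane. (\<lambda>n. a n * hecke_q \<mu> z ^ n) sums f z)"

text \<open>Intended for even weights only. Values outside the upper half plane are irrelevant.\<close>

definition automorphic_forms :: "nat \<Rightarrow> int \<Rightarrow> (complex \<Rightarrow> complex) set" where
  "automorphic_forms \<mu> v =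
     {f. f holomorphic_on upper_half_plane \<and>
         (\<forall>A\<in>hecke_group \<mu>. \<forall>z\<in>upper_half_plane.
            f (moebius_act A z) = aut_denom A z powi v * f z) \<and>
         (\<exists>a. has_q_expansion \<mu> f a)}"

definition is_hecke_E2 :: "nat \<Rightarrow> (complex \<Rightarrow> complex) \<Rightarrow> bool" where
  "is_hecke_E2 \<mu> E2 \<longleftrightarrow>
     E2 holomorphic_on upper_half_plane \<and>
     (\<exists>e. e 0 = 1 \<and> has_q_expansion \<mu> E2 e) \<and>
     (\<exists>C. \<forall>A\<in>hecke_group \<mu>. \<forall>z\<in>upper_half_plane.
        E2 (moebius_act A z) / aut_denom A z ^ 2 =
          E2 z + C * of_real (A $ 2 $ 1) / aut_denom A z)"

definition hecke_theta :: "nat \<Rightarrow> (complex \<Rightarrow> complex) \<Rightarrow> complex \<Rightarrow> complex" where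
  "hecke_theta \<mu> f z = of_real (hecke_width \<mu>) / (2 * of_real pi * \<i>) * deriv f z"

definition serre_deriv ::
    "nat \<Rightarrow> (complex \<Rightarrow> complex) \<Rightarrow> int \<Rightarrow> (complex \<Rightarrow> complex) \<Rightarrow> complex \<Rightarrow> complex" where
  "serre_deriv \<mu> E2 v f z =
     hecke_theta \<mu> f z - of_int v * (of_nat \<mu> - 2) / (4 * of_nat \<mu>) * E2 z * f z"

primrec serre_iter ::
    "nat \<Rightarrow> (complex \<Rightarrow> complex) \<Rightarrow> int \<Rightarrow> nat \<Rightarrow> (complex \<Rightarrow> complex) \<Rightarrow> complex \<Rightarrow> complex" where
  "serre_iter \<mu> E2 v 0 f = f"
| "serre_iter \<mu> E2 v (Suc k) f = serre_deriv \<mu> E2 (v + 2 * int k) (serre_iter \<mu> E2 v k f)"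


section \<open>Hecke automorphic linear differential equations\<close>

definition hecke_operator ::
    "nat \<Rightarrow> (complex \<Rightarrow> complex) \<Rightarrow> int \<Rightarrow> nat \<Rightarrow> (nat \<Rightarrow> complex \<Rightarrow> complex)
      \<Rightarrow> (complex \<Rightarrow> complex) \<Rightarrow> complex \<Rightarrow> complex" where
  "hecke_operator \<mu> E2 w r B y z =
     serre_iter \<mu> E2 (w - int r) (r + 1) y z +
     (\<Sum>j = 2..r + 1. B (2 * j) z * serre_iter \<mu> E2 (w - int r) (r + 1 - j) y z)"

definition hecke_solutions ::
    "nat \<Rightarrow> (complex \<Rightarrow> complex) \<Rightarrow> int \<Rightarrow> nat \<Rightarrow> (nat \<Rightarrow> complex \<Rightarrow> complex)
      \<Rightarrow> (complex \<Rightarrow> complex) set" where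
  "hecke_solutions \<mu> E2 w r B =
     {y. y holomorphic_on upper_half_plane \<and>
         (\<forall>z\<in>upper_half_plane. hecke_operator \<mu> E2 w r B y z = 0)}"

text \<open>Basis of the solution space, where functions agreeing on the upper half plane are identified.\<close>

definition fundamental_solution_vector ::
    "nat \<Rightarrow> (complex \<Rightarrow> complex) \<Rightarrow> int \<Rightarrow> nat \<Rightarrow> (nat \<Rightarrow> complex \<Rightarrow> complex)
      \<Rightarrow> (nat \<Rightarrow> complex \<Rightarrow> complex) \<Rightarrow> bool" where
  "fundamental_solution_vector \<mu> E2 w r B Y \<longleftrightarrow>
     (\<forall>i\<le>r. Y i \<in> hecke_solutions \<mu> E2 w r B) \<and>
     (\<forall>c :: nat \<Rightarrow> complex. (\<forall>z\<in>upper_half_plane. (\<Sum>i\<le>r. c i * Y i z) = 0) \<longrightarrow> (\<forall>i\<le>r. c i = 0)) \<and>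
     (\<forall>y\<in>hecke_solutions \<mu> E2 w r B.
        \<exists>c :: nat \<Rightarrow> complex. \<forall>z\<in>upper_half_plane. y z = (\<Sum>i\<le>r. c i * Y i z))"

text \<open>The determinant of matrices of arbitrary size, not the one indexed by finite types.\<close>

definition serre_wronskian ::
    "nat \<Rightarrow> (complex \<Rightarrow> complex) \<Rightarrow> int \<Rightarrow> nat \<Rightarrow> (nat \<Rightarrow> complex \<Rightarrow> complex) \<Rightarrow> complex \<Rightarrow> complex" where
  "serre_wronskian \<mu> E2 w r Y z =
     Determinant.det
       (Matrix.mat (r + 1) (r + 1) (\<lambda>(i, k). serre_iter \<mu> E2 (w - int r) k (Y i) z))"

text \<open>
  Here \<open>a j n\<close> is the \<open>n\<close>-th coefficient of \<open>A\<^sub>j\<close>. The identity of differential operators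
  determines the \<open>A\<^sub>j\<close> with \<open>j \<le> r\<close>, and hence these coefficients, uniquely.
\<close>

definition is_theta_form ::
    "nat \<Rightarrow> (complex \<Rightarrow> complex) \<Rightarrow> int \<Rightarrow> nat \<Rightarrow> (nat \<Rightarrow> complex \<Rightarrow> complex)
      \<Rightarrow> (nat \<Rightarrow> complex \<Rightarrow> complex) \<Rightarrow> (nat \<Rightarrow> nat \<Rightarrow> complex) \<Rightarrow> bool" where
  "is_theta_form \<mu> E2 w r B A a \<longleftrightarrow>
     (\<forall>j\<le>r. has_q_expansion \<mu> (A j) (a j)) \<and>
     (\<forall>y. y holomorphic_on upper_half_plane \<longrightarrow>
        (\<forall>z\<in>upper_half_plane.
           hecke_operator \<mu> E2 w r B y z =
             (hecke_theta \<mu> ^^ (r + 1)) y z + (\<Sum>j\<le>r. A j z * (hecke_theta \<mu> ^^ j) y z)))"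

definition indicial_poly :: "nat \<Rightarrow> (nat \<Rightarrow> nat \<Rightarrow> complex) \<Rightarrow> complex poly" where
  "indicial_poly r a = monom 1 (r + 1) + (\<Sum>j\<le>r. monom (a j 0) j)"

definition has_vanishing_orders ::
    "nat \<Rightarrow> (complex \<Rightarrow> complex) \<Rightarrow> int \<Rightarrow> nat \<Rightarrow> (nat \<Rightarrow> complex \<Rightarrow> complex)
      \<Rightarrow> complex multiset \<Rightarrow> bool" where
  "has_vanishing_orders \<mu> E2 w r B \<Lambda> \<longleftrightarrow>
     (\<exists>A a. is_theta_form \<mu> E2 w r B A a \<and> \<Lambda> = proots (indicial_poly r a))"


section \<open>Hauptmodul and automorphic discriminant\<close>

definition hecke_vertex :: "nat \<Rightarrow> complex" where
  "hecke_vertex \<mu> = - exp (- (of_real pi * \<i> / of_nat \<mu>))"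

text \<open>Interior of the hyperbolic triangle with vertices \<open>\<i>\<close>, \<open>hecke_vertex \<mu>\<close> and \<open>\<i>\<infinity>\<close>.\<close>

definition hecke_triangle :: "nat \<Rightarrow> complex set" where
  "hecke_triangle \<mu> = {z. Im z > 0 \<and> Re (hecke_vertex \<mu>) < Re z \<and> Re z < 0 \<and> norm z > 1}"

definition is_hecke_hauptmodul :: "nat \<Rightarrow> (complex \<Rightarrow> complex) \<Rightarrow> bool" where
  "is_hecke_hauptmodul \<mu> J \<longleftrightarrow>
     J holomorphic_on upper_half_plane \<and>
     (\<forall>A\<in>hecke_group \<mu>. \<forall>z\<in>upper_half_plane. J (moebius_act A z) = J z) \<and>
     bij_betw J (hecke_triangle \<mu>) upper_half_plane \<and>
     J \<i> = 1 \<and> J (hecke_vertex \<mu>) = 0 \<and>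
     filterlim J at_infinity (filtercomap Im at_top)"

definition disc_weight :: "nat \<Rightarrow> nat" where
  "disc_weight \<mu> = 2 * lcm 2 \<mu>"

text \<open>
  The defining quotient has removable singularities where \<open>J\<close> equals 0 or 1. There, the
  formula alone would produce the wrong value because of the convention \<open>x / 0 = 0\<close>.
\<close>

definition hecke_discriminant :: "nat \<Rightarrow> (complex \<Rightarrow> complex) \<Rightarrow> complex \<Rightarrow> complex" where
  "hecke_discriminant \<mu> J = remove_sings (\<lambda>z.
     if even \<mu>
     then (hecke_theta \<mu> J z / (J z * (J z - 1))) ^ \<mu> * J z * (J z - 1) ^ (\<mu> div 2)
     else (hecke_theta \<mu> J z / (J z * (J z - 1))) ^ (2 * \<mu>) * J z ^ 2 * (J z - 1) ^ \<mu>)"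

text \<open>
  \<open>P\<close> is a holomorphic branch of \<open>F\<^sup>s\<close> on the upper half plane, i.e. \<open>exp (s L)\<close> for a
  holomorphic logarithm \<open>L\<close> of \<open>F\<close>. For integral \<open>s\<close> this is the ordinary power.
\<close>

definition is_power_branch :: "(complex \<Rightarrow> complex) \<Rightarrow> complex \<Rightarrow> (complex \<Rightarrow> complex) \<Rightarrow> bool" where
  "is_power_branch F s P \<longleftrightarrow>
     (\<exists>L. L holomorphic_on upper_half_plane \<and>
          (\<forall>z\<in>upper_half_plane. F z = exp (L z) \<and> P z = exp (s * L z)))"

lemma is_power_branch_of_int:
  assumes "is_power_branch F (of_int n) P" "z \<in> upper_half_plane"
  shows   "P z = F z powi n"
  using assms by (auto simp: is_power_branch_def exp_power_int)

end

theory Submission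
  imports Defs
begin

text \<open>
  The Serre derivative of the Wronskian vanishes because the equation has no term of order \<open>r\<close>, so
  the logarithmic derivative of the Wronskian is a multiple of \<open>E\<^sub>2\<close>. It remains to see that the
  discriminant is a nonvanishing function with the same property, i.e. that
  \<open>J'\<^bsup>2\<mu>\<^esup> = C J\<^bsup>2\<mu>-2\<^esup> (J - 1)\<^bsup>\<mu>\<^esup> exp ((\<mu> - 2) L)\<close> for a primitive \<open>L\<close> of \<open>(2\<pi>\<i> / \<varpi>) E\<^sub>2\<close>. The quotient of the two sides is
  invariant under the group. On the hyperbolic triangle, it is holomorphic, it extends continuously to the
  sides, the vertices and \<open>\<i>\<infinity>\<close>, and its parts symmetric under \<open>z \<mapsto> - cnj z\<close> are real on the boundary,
  so it is constant by the maximum modulus principle.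
\<close>

section \<open>Determinants and linear differential systems\<close>

text \<open>The exponents come from the corners of the triangle. The hauptmodul is given by a
  bijection of the open triangle and its values at the corners, so the zero order n of J at the
  vertex and of J - 1 at \<i> is approached through invariance under the elliptic elements fixing
  these points: it forces \<mu> to divide n at the vertex and 2 to divide n at \<i>. The lower bound
  n \<ge> \<mu> is exactly what makes J'^(2\<mu>) / J^(2\<mu>-2) bounded at the vertex, and n \<ge>
  2 does the same for J'^(2\<mu>) / (J-1)^\<mu> at \<i>. Exact orders and a valence formula are
  avoided. The factor exp ((\<mu>-2) L) matches the weight 4\<mu> of the quotient because the angle
  at the vertex fixes the constant in the transformation law of L. One triangle is enough, since the
  identity spreads to the half plane by analytic continuation. Nonvanishing of the discriminant is
  not obtained by locating zeros: it follows from C \<noteq> 0, and C = 0 would make J constant. For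
  even \<mu> the identity describes the square of the discriminant, so a square root has to be
  extracted on a connected set.\<close>

lemma cofactor_cong:
  assumes "A \<in> carrier_mat n n" "A' \<in> carrier_mat n n" "j < n"
    and "\<And>i k. i < n \<Longrightarrow> k < n \<Longrightarrow> k \<noteq> j \<Longrightarrow> A $$ (i, k) = A' $$ (i, k)"
  shows "cofactor A i j = cofactor A' i j"
proof -
  have "mat_delete A i j = mat_delete A' i j"
    using assms by (intro eq_matI) (auto simp: mat_delete_def)
  then show ?thesis by (simp add: cofactor_def)
qed

text \<open>Differentiating the Leibniz formula gives, for each k, the determinant with column k
  replaced by its derivative; Laplace expansion along that column produces the cofactors of the
  original matrix. The Leibniz formula is first transposed so that its products run over
  columns.\<close>

lemma has_field_derivative_det:
  fixes M M' :: "nat \<Rightarrow> nat \<Rightarrow> complex \<Rightarrow> complex"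
  assumes "\<And>i k. i < n \<Longrightarrow> k < n \<Longrightarrow> (M i k has_field_derivative M' i k z) (at z)"
  shows "((\<lambda>z. Determinant.det (Matrix.mat n n (\<lambda>(i, k). M i k z))) has_field_derivative
    (\<Sum>k<n. \<Sum>i<n. M' i k z * cofactor (Matrix.mat n n (\<lambda>(i, k). M i k z)) i k)) (at z)"
proof -
  define A where "A = Matrix.mat n n (\<lambda>(i, k). M i k z)"
  define R where "R k = Matrix.mat n n (\<lambda>(i, l). if l = k then M' i l z else M i l z)" for k
  let ?P = "{p. p permutes {0..<n}}"
  have detT: "Determinant.det B = (\<Sum>p\<in>?P. signof p * (\<Prod>k = 0..<n. B $$ (p k, k)))"
    if B: "B \<in> carrier_mat n n" for B :: "complex mat"
  proof -
    have "Determinant.det B = Determinant.det (transpose_mat B)"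
      using det_transpose[OF B] by simp
    also have "\<dots> = (\<Sum>p\<in>?P. signof p * (\<Prod>k = 0..<n. transpose_mat B $$ (k, p k)))"
      using B by (intro det_def') auto
    also have "\<dots> = (\<Sum>p\<in>?P. signof p * (\<Prod>k = 0..<n. B $$ (p k, k)))"
    proof (intro sum.cong refl arg_cong2[of _ _ _ _ "(*)"] prod.cong)
      fix p k assume "p \<in> ?P" "k \<in> {0..<n}"
      then have "p k < n" using permutes_in_image[of p "{0..<n}" k] by simp
      then show "transpose_mat B $$ (k, p k) = B $$ (p k, k)" using B \<open>k \<in> _\<close> by auto
    qed
    finally show ?thesis .
  qed
  have pin: "p k < n" if "p \<in> ?P" "k \<in> {0..<n}" for p k
    using that permutes_in_image[of p "{0..<n}" k] by simp
  have eq: "Determinant.det (Matrix.mat n n (\<lambda>(i, k). M i k z)) =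
      (\<Sum>p\<in>?P. signof p * (\<Prod>k = 0..<n. M (p k) k z))" for z
    using pin by (subst detT) (auto intro!: sum.cong prod.cong)
  have "((\<lambda>z. \<Sum>p\<in>?P. signof p * (\<Prod>k = 0..<n. M (p k) k z)) has_field_derivative
      (\<Sum>p\<in>?P. signof p * (\<Sum>k = 0..<n. M' (p k) k z * (\<Prod>l\<in>{0..<n}-{k}. M (p l) l z)))) (at z)"
    using pin by (intro DERIV_sum DERIV_cmult has_field_derivative_prod assms) auto
  also have "(\<Sum>p\<in>?P. signof p * (\<Sum>k = 0..<n. M' (p k) k z * (\<Prod>l\<in>{0..<n}-{k}. M (p l) l z))) =
      (\<Sum>k = 0..<n. \<Sum>p\<in>?P. signof p * (M' (p k) k z * (\<Prod>l\<in>{0..<n}-{k}. M (p l) l z)))"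
    by (simp add: sum_distrib_left) (rule sum.swap)
  also have "\<dots> = (\<Sum>k = 0..<n. Determinant.det (R k))"
  proof (intro sum.cong refl)
    fix k assume k: "k \<in> {0..<n}"
    have "M' (p k) k z * (\<Prod>l\<in>{0..<n}-{k}. M (p l) l z) = (\<Prod>l = 0..<n. R k $$ (p l, l))"
      if "p \<in> ?P" for p
      using k pin[OF that] by (subst prod.remove[of _ k]) (auto simp: R_def intro!: prod.cong)
    then show "(\<Sum>p\<in>?P. signof p * (M' (p k) k z * (\<Prod>l\<in>{0..<n}-{k}. M (p l) l z))) =
        Determinant.det (R k)"
      by (subst detT) (auto simp: R_def intro!: sum.cong)
  qed
  also have "\<dots> = (\<Sum>k<n. \<Sum>i<n. M' i k z * cofactor A i k)"
    unfolding atLeast0LessThan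
  proof (intro sum.cong refl)
    fix k assume k: "k \<in> {..<n}"
    have "Determinant.det (R k) = (\<Sum>i<n. R k $$ (i, k) * cofactor (R k) i k)"
      using k by (intro laplace_expansion_column) (auto simp: R_def)
    also have "\<dots> = (\<Sum>i<n. M' i k z * cofactor A i k)"
      using k by (intro sum.cong refl arg_cong2[of _ _ _ _ "(*)"] cofactor_cong[of _ n])
        (auto simp: R_def A_def)
    finally show "Determinant.det (R k) = (\<Sum>i<n. M' i k z * cofactor A i k)" .
  qed
  finally show ?thesis by (simp add: eq A_def)
qed

text \<open>The sum is the entry (k, l) of \<open>adj_mat A * A\<close>, which is the determinant
  times the identity matrix.\<close>

lemma sum_mult_cofactor:
  assumes A: "A \<in> carrier_mat n n" and "l < n" "k < n"
  shows "(\<Sum>i<n. A $$ (i, l) * cofactor A i k) = (if k = l then Determinant.det A else 0)"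
proof -
  have "(\<Sum>i<n. A $$ (i, l) * cofactor A i k) = (adj_mat A * A) $$ (k, l)"
    using assms by (auto simp: adj_mat_def scalar_prod_def atLeast0LessThan mult.commute intro!: sum.cong)
  also have "\<dots> = (if k = l then Determinant.det A else 0)"
    using assms by (subst adj_mat(3)[OF A]) auto
  finally show ?thesis .
qed

text \<open>Liouville's formula: each row of M is a solution of the same linear system. Sums of one
  column against the cofactors of another vanish, so only the trace of the coefficient matrix
  survives.\<close>

lemma has_field_derivative_det_linear_system:
  fixes M :: "nat \<Rightarrow> nat \<Rightarrow> complex \<Rightarrow> complex"
  assumes "\<And>i k. i < n \<Longrightarrow> k < n \<Longrightarrow>
    (M i k has_field_derivative (\<Sum>l<n. a k l * M i l z)) (at z)"
  shows "((\<lambda>z. Determinant.det (Matrix.mat n n (\<lambda>(i, k). M i k z))) has_field_derivative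
    (\<Sum>k<n. a k k) * Determinant.det (Matrix.mat n n (\<lambda>(i, k). M i k z))) (at z)"
proof -
  define A where "A = Matrix.mat n n (\<lambda>(i, k). M i k z)"
  have A: "A \<in> carrier_mat n n" by (simp add: A_def)
  have "(\<Sum>i<n. (\<Sum>l<n. a k l * M i l z) * cofactor A i k) = a k k * Determinant.det A"
    if k: "k < n" for k
  proof -
    have "(\<Sum>i<n. (\<Sum>l<n. a k l * M i l z) * cofactor A i k) =
        (\<Sum>i<n. \<Sum>l<n. a k l * (A $$ (i, l) * cofactor A i k))"
      by (intro sum.cong refl) (simp add: A_def sum_distrib_right mult.assoc)
    also have "\<dots> = (\<Sum>l<n. a k l * (\<Sum>i<n. A $$ (i, l) * cofactor A i k))"
      by (subst sum.swap) (simp add: sum_distrib_left)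
    also have "\<dots> = (\<Sum>l<n. if l = k then a k l * Determinant.det A else 0)"
      using k by (intro sum.cong refl) (simp add: sum_mult_cofactor[OF A])
    also have "\<dots> = a k k * Determinant.det A"
      using k by simp
    finally show ?thesis .
  qed
  then have eq: "(\<Sum>k<n. \<Sum>i<n. (\<Sum>l<n. a k l * M i l z) * cofactor A i k) =
      (\<Sum>k<n. a k k) * Determinant.det A"
    by (simp add: sum_distrib_right)
  show ?thesis
    using has_field_derivative_det[of n M "\<lambda>i k z. \<Sum>l<n. a k l * M i l z" z] assms eq
    by (simp add: A_def)
qed

text \<open>By strong induction on the order, simultaneously for all components, the Leibniz rule
  applied to the system shows that every derivative vanishes at z0. The identity theorem finishes
  the argument.\<close>

lemma linear_system_unique:
  fixes y :: "nat \<Rightarrow> complex \<Rightarrow> complex"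
  assumes S: "open S" "connected S" and z0: "z0 \<in> S"
    and hol: "\<And>k. k < n \<Longrightarrow> y k holomorphic_on S"
    and a: "\<And>k l. k < n \<Longrightarrow> l < n \<Longrightarrow> a k l holomorphic_on S"
    and deriv: "\<And>k z. k < n \<Longrightarrow> z \<in> S \<Longrightarrow> deriv (y k) z = (\<Sum>l<n. a k l z * y l z)"
    and init: "\<And>k. k < n \<Longrightarrow> y k z0 = 0"
    and k: "k < n" and z: "z \<in> S"
  shows "y k z = 0"
proof -
  have *: "(deriv ^^ m) (y k) z0 = 0" if "k < n" for m k
    using that
  proof (induction m arbitrary: k rule: less_induct)
    case (less m)
    show ?case
    proof (cases m)
      case 0
      then show ?thesis using init less.prems by simp
    next
      case (Suc m')
      have hols: "(\<lambda>z. \<Sum>l<n. a k l z * y l z) holomorphic_on S"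
        using a hol less.prems by (intro holomorphic_intros) auto
      have "(deriv ^^ m) (y k) z0 = (deriv ^^ m') (deriv (y k)) z0"
        unfolding Suc by (simp add: funpow_swap1)
      also have "\<dots> = (deriv ^^ m') (\<lambda>z. \<Sum>l<n. a k l z * y l z) z0"
        using less.prems deriv hols hol S z0
        by (intro higher_deriv_transform_within_open[of _ S]) (auto intro!: holomorphic_deriv)
      also have "\<dots> = (\<Sum>l<n. (deriv ^^ m') (\<lambda>z. a k l z * y l z) z0)"
      proof -
        have "(deriv ^^ m') (\<lambda>z. \<Sum>l\<in>I. a k l z * y l z) z0 =
            (\<Sum>l\<in>I. (deriv ^^ m') (\<lambda>z. a k l z * y l z) z0)" if "I \<subseteq> {..<n}" for I
          using finite_subset[OF that finite_lessThan] that
        proof (induction I rule: finite_induct)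
          case (insert x F)
          then show ?case
            using a hol less.prems S z0
            by (simp, subst higher_deriv_add[of _ S])
               (auto intro!: holomorphic_intros simp: subset_iff)
        qed simp
        then show ?thesis by blast
      qed
      also have "\<dots> = 0"
      proof (intro sum.neutral ballI)
        fix l assume l: "l \<in> {..<n}"
        have "(deriv ^^ m') (\<lambda>z. a k l z * y l z) z0 = (\<Sum>i = 0..m'. of_nat (m' choose i) *
            (deriv ^^ i) (a k l) z0 * (deriv ^^ (m' - i)) (y l) z0)"
          using a hol less.prems l S z0 by (intro higher_deriv_mult) auto
        also have "\<dots> = 0"
          using l less.IH Suc by (intro sum.neutral) auto
        finally show "(deriv ^^ m') (\<lambda>z. a k l z * y l z) z0 = 0" .
      qed
      finally show ?thesis .
    qed
  qed
  show ?thesis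
    using holomorphic_fun_eq_0_on_connected[OF hol[OF k] S *[OF k] z0 z] .
qed

section \<open>The Wronskian of a Hecke automorphic equation\<close>

lemma open_upper_half_plane: "open upper_half_plane"
  by (simp add: upper_half_plane_def open_halfspace_Im_gt)

lemma convex_upper_half_plane: "convex upper_half_plane"
  by (simp add: upper_half_plane_def convex_halfspace_Im_gt)

lemma connected_upper_half_plane: "connected upper_half_plane"
  by (simp add: convex_connected convex_upper_half_plane)

lemma ii_in_upper_half_plane [simp]: "\<i> \<in> upper_half_plane"
  by (simp add: upper_half_plane_def)

lemma hecke_width_pos:
  assumes "\<mu> \<ge> 3"
  shows "hecke_width \<mu> > 0"
proof -
  have "pi / real \<mu> \<le> pi / 3"
    using assms by (intro divide_left_mono) auto
  then have "pi / real \<mu> < pi / 2"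
    using pi_gt_zero by linarith
  moreover have "- (pi / 2) < pi / real \<mu>"
    by (rule less_le_trans[of _ 0]) auto
  ultimately show ?thesis
    unfolding hecke_width_def by (intro mult_pos_pos cos_gt_zero_pi) auto
qed

lemma has_field_derivative_zero_imp_const:
  assumes "\<And>z. z \<in> upper_half_plane \<Longrightarrow> (f has_field_derivative 0) (at z)"
  obtains c where "\<And>z. z \<in> upper_half_plane \<Longrightarrow> f z = c"
  using has_field_derivative_zero_constant[OF convex_upper_half_plane, of f] assms
  by (metis has_field_derivative_at_within)

section \<open>The equation as a first-order system for the Serre iterates\<close>

lemma holomorphic_serre_iter:
  assumes "E2 holomorphic_on upper_half_plane" "f holomorphic_on upper_half_plane"
  shows "serre_iter \<mu> E2 v k f holomorphic_on upper_half_plane"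
proof (induction k)
  case (Suc k)
  have "serre_iter \<mu> E2 v (Suc k) f = (\<lambda>z. of_real (hecke_width \<mu>) / (2 * of_real pi * \<i>) *
      deriv (serre_iter \<mu> E2 v k f) z -
      of_int (v + 2 * int k) * (of_nat \<mu> - 2) / (4 * of_nat \<mu>) * E2 z * serre_iter \<mu> E2 v k f z)"
    by (simp add: serre_deriv_def[abs_def] hecke_theta_def)
  then show ?case
    using Suc assms by (auto intro!: holomorphic_intros simp: open_upper_half_plane)
qed (use assms in simp)

text \<open>The companion matrix of the equation for the vector of Serre iterates, written for d/dz
  instead of \<open>hecke_theta\<close>, which explains the factor in front. The second summand
  brings the E2 term of the Serre derivative to the other side. The entry (r, r) of the companion
  part is 0 because the equation has no term with B_2.\<close>

definition hecke_system ::
    "nat \<Rightarrow> (complex \<Rightarrow> complex) \<Rightarrow> int \<Rightarrow> nat \<Rightarrow> (nat \<Rightarrow> complex \<Rightarrow> complex)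
      \<Rightarrow> nat \<Rightarrow> nat \<Rightarrow> complex \<Rightarrow> complex" where
  "hecke_system \<mu> E2 w r B k l z = 2 * of_real pi * \<i> / of_real (hecke_width \<mu>) *
     ((if k < r then (if l = Suc k then 1 else 0) else (if l < r then - B (2 * (r + 1 - l)) z else 0)) +
      (if l = k then of_int (w - int r + 2 * int k) * (of_nat \<mu> - 2) / (4 * of_nat \<mu>) * E2 z else 0))"

lemma deriv_serre_iter:
  assumes \<mu>: "\<mu> \<ge> 3" and y: "y \<in> hecke_solutions \<mu> E2 w r B"
    and z: "z \<in> upper_half_plane" and k: "k \<le> r"
  shows "deriv (serre_iter \<mu> E2 (w - int r) k y) z =
    (\<Sum>l<r + 1. hecke_system \<mu> E2 w r B k l z * serre_iter \<mu> E2 (w - int r) l y z)"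
proof -
  define t where "t = 2 * of_real pi * \<i> / of_real (hecke_width \<mu>)"
  define b where "b = of_int (w - int r + 2 * int k) * (of_nat \<mu> - 2) / (4 * of_nat \<mu>) * E2 z"
  define S where "S l = serre_iter \<mu> E2 (w - int r) l y" for l
  define a where "a l = (if k < r then (if l = Suc k then 1 else 0) else
    (if l < r then - B (2 * (r + 1 - l)) z else 0))" for l
  have "S (Suc k) z = 1 / t * deriv (S k) z - b * S k z"
    by (simp add: S_def t_def b_def serre_deriv_def hecke_theta_def)
  moreover have "t \<noteq> 0"
    using hecke_width_pos[OF \<mu>] by (simp add: t_def)
  ultimately have d: "deriv (S k) z = t * (S (Suc k) z + b * S k z)"
    by simp
  have "S (Suc k) z = (\<Sum>l<r + 1. a l * S l z)"
  proof (cases "k < r")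
    case True
    then have "(\<Sum>l<r + 1. a l * S l z) = (\<Sum>l<r + 1. if l = Suc k then S l z else 0)"
      by (intro sum.cong) (auto simp: a_def)
    also have "\<dots> = S (Suc k) z" using True by simp
    finally show ?thesis by simp
  next
    case False
    then have kr: "k = r" using k by simp
    have "hecke_operator \<mu> E2 w r B y z = 0"
      using y z by (simp add: hecke_solutions_def)
    then have "S (Suc k) z = - (\<Sum>j = 2..r + 1. B (2 * j) z * S (r + 1 - j) z)"
      by (simp add: hecke_operator_def S_def kr eq_neg_iff_add_eq_0 del: serre_iter.simps(2))
    also have "(\<Sum>j = 2..r + 1. B (2 * j) z * S (r + 1 - j) z) =
        (\<Sum>l<r. B (2 * (r + 1 - l)) z * S l z)"
      by (rule sum.reindex_bij_witness[of _ "\<lambda>l. r + 1 - l" "\<lambda>j. r + 1 - j"]) auto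
    also have "- \<dots> = (\<Sum>l<r + 1. a l * S l z)"
      by (simp add: a_def kr sum_negf)
    finally show ?thesis .
  qed
  moreover have "b * S k z = (\<Sum>l<r + 1. (if l = k then b else 0) * S l z)"
  proof -
    have "(\<Sum>l<r + 1. (if l = k then b else 0) * S l z) = (\<Sum>l<r + 1. if l = k then b * S l z else 0)"
      by (intro sum.cong) auto
    then show ?thesis using k by simp
  qed
  ultimately have "deriv (S k) z = (\<Sum>l<r + 1. t * (a l + (if l = k then b else 0)) * S l z)"
    unfolding d by (simp add: sum.distrib[symmetric] sum_distrib_left algebra_simps)
  also have "\<dots> = (\<Sum>l<r + 1. hecke_system \<mu> E2 w r B k l z * S l z)"
    by (intro sum.cong refl) (simp only: hecke_system_def t_def[symmetric] b_def[symmetric] a_def)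
  finally show ?thesis by (simp add: S_def)
qed

text \<open>The companion part has zero diagonal, so only the weights w - r, w - r + 2, ..., w + r
  contribute; their mean is w.\<close>

lemma trace_hecke_system:
  "(\<Sum>k<r + 1. hecke_system \<mu> E2 w r B k k z) = 2 * of_real pi * \<i> / of_real (hecke_width \<mu>) *
     (of_int w * of_nat (r + 1) * (of_nat \<mu> - 2) / (4 * of_nat \<mu>)) * E2 z"
proof -
  have "(\<Sum>k<r + 1. (of_int (w - int r + 2 * int k) :: complex)) = of_int w * of_nat (r + 1)"
  proof -
    \<comment> \<open>Induction needs the number of summands to vary while the r inside the summand
      stays fixed; the case m = r is the one wanted.\<close>
    have "(\<Sum>k<m + 1. w - int r + 2 * int k) = (w - int r + int m) * int (m + 1)" for m
      by (induction m) (auto simp: algebra_simps)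
    from arg_cong[OF this[of r], of "of_int :: int \<Rightarrow> complex"] show ?thesis by simp
  qed
  then have "(\<Sum>k<r + 1. of_int (w - int r + 2 * int k) * (of_nat \<mu> - 2) / (4 * of_nat \<mu>) * E2 z) =
      of_int w * of_nat (r + 1) * (of_nat \<mu> - 2) / (4 * of_nat \<mu>) * E2 z"
    by (simp only: sum_distrib_right[symmetric] sum_divide_distrib[symmetric])
  moreover have "hecke_system \<mu> E2 w r B k k z = 2 * of_real pi * \<i> / of_real (hecke_width \<mu>) *
     (of_int (w - int r + 2 * int k) * (of_nat \<mu> - 2) / (4 * of_nat \<mu>) * E2 z)" if "k < r + 1" for k
    using that by (simp add: hecke_system_def)
  ultimately have "(\<Sum>k<r + 1. hecke_system \<mu> E2 w r B k k z) =
      2 * of_real pi * \<i> / of_real (hecke_width \<mu>) *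
      (of_int w * of_nat (r + 1) * (of_nat \<mu> - 2) / (4 * of_nat \<mu>) * E2 z)"
    by (metis (no_types, lifting) sum.cong sum_distrib_left lessThan_iff)
  then show ?thesis by (simp only: mult.assoc)
qed

lemma holomorphic_hecke_system:
  assumes "E2 holomorphic_on upper_half_plane"
    and "\<And>j. 2 \<le> j \<Longrightarrow> j \<le> r + 1 \<Longrightarrow> B (2 * j) holomorphic_on upper_half_plane"
  shows "hecke_system \<mu> E2 w r B k l holomorphic_on upper_half_plane"
proof -
  have "(\<lambda>z. (if k < r then (if l = Suc k then 1 else 0) else
      (if l < r then - B (2 * (r + 1 - l)) z else 0))) holomorphic_on upper_half_plane"
    using assms(2)[of "r + 1 - l"]
    by (cases "k < r"; cases "l < r"; cases "l = Suc k") (auto intro!: holomorphic_intros)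
  moreover have "(\<lambda>z. if l = k then of_int (w - int r + 2 * int k) * (of_nat \<mu> - 2) / (4 * of_nat \<mu>)
      * E2 z else 0) holomorphic_on upper_half_plane"
    using assms(1) by (cases "l = k") (auto intro!: holomorphic_intros)
  ultimately show ?thesis
    unfolding hecke_system_def[abs_def] by (intro holomorphic_intros)
qed

text \<open>This is the vanishing of the Serre derivative of weight w (r + 1) of the Wronskian,
  solved for the ordinary derivative.\<close>

lemma has_field_derivative_serre_wronskian:
  assumes \<mu>: "\<mu> \<ge> 3" and E2: "E2 holomorphic_on upper_half_plane"
    and Y: "\<And>i. i \<le> r \<Longrightarrow> Y i \<in> hecke_solutions \<mu> E2 w r B"
    and z: "z \<in> upper_half_plane"
  shows "(serre_wronskian \<mu> E2 w r Y has_field_derivative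
     2 * of_real pi * \<i> / of_real (hecke_width \<mu>) *
     (of_int w * of_nat (r + 1) * (of_nat \<mu> - 2) / (4 * of_nat \<mu>)) * E2 z *
     serre_wronskian \<mu> E2 w r Y z) (at z)"
proof -
  have "((\<lambda>z. serre_iter \<mu> E2 (w - int r) k (Y i) z) has_field_derivative
      (\<Sum>l<r + 1. hecke_system \<mu> E2 w r B k l z * serre_iter \<mu> E2 (w - int r) l (Y i) z)) (at z)"
    if "i < r + 1" "k < r + 1" for i k
  proof -
    have "Y i holomorphic_on upper_half_plane"
      using Y[of i] that by (simp add: hecke_solutions_def)
    from holomorphic_derivI[OF holomorphic_serre_iter[OF E2 this] open_upper_half_plane z,
        of \<mu> "w - int r" k UNIV]
    show ?thesis
      using deriv_serre_iter[OF \<mu> Y z, of i k] that by (simp del: sum.lessThan_Suc)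
  qed
  from has_field_derivative_det_linear_system[where n = "r + 1" and
      M = "\<lambda>i k. serre_iter \<mu> E2 (w - int r) k (Y i)", OF this]
  show ?thesis
    unfolding trace_hecke_system serre_wronskian_def[abs_def] .
qed

text \<open>A kernel vector of the transposed matrix at z0 gives a combination of the Y i whose
  Serre iterates of order 0 to r all vanish at z0. By uniqueness for the system it is zero
  everywhere, against linear independence.\<close>

lemma serre_wronskian_nonzero:
  assumes \<mu>: "\<mu> \<ge> 3" and E2: "E2 holomorphic_on upper_half_plane"
    and B: "\<And>j. 2 \<le> j \<Longrightarrow> j \<le> r + 1 \<Longrightarrow> B (2 * j) holomorphic_on upper_half_plane"
    and Y: "fundamental_solution_vector \<mu> E2 w r B Y"
    and z0: "z0 \<in> upper_half_plane"
  shows "serre_wronskian \<mu> E2 w r Y z0 \<noteq> 0"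
proof
  define S where "S k i = serre_iter \<mu> E2 (w - int r) k (Y i)" for k i
  define A where "A = Matrix.mat (r + 1) (r + 1) (\<lambda>(i, k). S k i z0)"
  have Ysol: "Y i \<in> hecke_solutions \<mu> E2 w r B" if "i \<le> r" for i
    using Y that by (simp add: fundamental_solution_vector_def)
  have holS: "S k i holomorphic_on upper_half_plane" if "i \<le> r" for k i
    using holomorphic_serre_iter[OF E2] Ysol[OF that] by (simp add: S_def hecke_solutions_def)
  assume "serre_wronskian \<mu> E2 w r Y z0 = 0"
  then have "Determinant.det A = 0"
    by (simp add: serre_wronskian_def A_def S_def)
  then have "Determinant.det (transpose_mat A) = 0"
    by (subst det_transpose[of _ "r + 1"]) (auto simp: A_def)
  then obtain v where v: "v \<in> carrier_vec (r + 1)" "v \<noteq> 0\<^sub>v (r + 1)"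
      "transpose_mat A *\<^sub>v v = 0\<^sub>v (r + 1)"
    by (subst (asm) det_0_iff_vec_prod_zero[of _ "r + 1"]) (auto simp: A_def)
  \<comment> \<open>The combination is taken of the k-th iterates, not inside the iterate, so
    linearity of \<open>serre_iter\<close> is never called upon.\<close>
  define y where "y k z = (\<Sum>i<r + 1. vec_index v i * S k i z)" for k z
  have init: "y k z0 = 0" if "k < r + 1" for k
  proof -
    have "vec_index (transpose_mat A *\<^sub>v v) k = 0" using v(3) that by simp
    then show ?thesis
      using that v(1) by (simp add: y_def A_def scalar_prod_def mult.commute atLeast0LessThan)
  qed
  have deriv: "deriv (y k) z = (\<Sum>l<r + 1. hecke_system \<mu> E2 w r B k l z * y l z)"
    if "k < r + 1" and z: "z \<in> upper_half_plane" for k z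
  proof -
    have "(y k has_field_derivative (\<Sum>i<r + 1. vec_index v i * deriv (S k i) z)) (at z)"
      unfolding y_def using holomorphic_derivI[OF holS open_upper_half_plane z]
      by (intro DERIV_sum DERIV_cmult) auto
    then have "deriv (y k) z = (\<Sum>i<r + 1. vec_index v i * deriv (S k i) z)"
      by (rule DERIV_imp_deriv)
    also have "\<dots> = (\<Sum>i<r + 1. \<Sum>l<r + 1. hecke_system \<mu> E2 w r B k l z * (vec_index v i * S l i z))"
      using deriv_serre_iter[OF \<mu> Ysol z] that(1)
      by (intro sum.cong refl) (simp add: S_def sum_distrib_left algebra_simps)
    also have "\<dots> = (\<Sum>l<r + 1. hecke_system \<mu> E2 w r B k l z * y l z)"
      by (subst sum.swap) (simp add: y_def sum_distrib_left del: sum.lessThan_Suc)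
    finally show ?thesis .
  qed
  have holy: "y k holomorphic_on upper_half_plane" for k
    unfolding y_def by (intro holomorphic_on_sum holomorphic_on_mult holomorphic_on_const holS) auto
  have hola: "hecke_system \<mu> E2 w r B k l holomorphic_on upper_half_plane" for k l
    using E2 B by (rule holomorphic_hecke_system)
  have "y 0 z = 0" if "z \<in> upper_half_plane" for z
    using linear_system_unique[where n = "r + 1" and y = y and a = "hecke_system \<mu> E2 w r B",
        OF open_upper_half_plane connected_upper_half_plane z0 holy
          hola deriv init _ that]
    by simp
  then have sum0: "(\<Sum>i\<le>r. vec_index v i * Y i z) = 0" if "z \<in> upper_half_plane" for z
    using that by (simp add: y_def S_def lessThan_Suc_atMost)
  have "\<forall>c :: nat \<Rightarrow> complex.
      (\<forall>z\<in>upper_half_plane. (\<Sum>i\<le>r. c i * Y i z) = 0) \<longrightarrow> (\<forall>i\<le>r. c i = 0)"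
    using Y unfolding fundamental_solution_vector_def by (elim conjE)
  from this[THEN spec, of "vec_index v"] sum0 have "vec_index v i = 0" if "i \<le> r" for i
    using that by simp
  then have "v = 0\<^sub>v (r + 1)"
    using v(1) by (intro eq_vecI) auto
  then show False using v(2) by simp
qed

section \<open>The quasiautomorphic form of weight 2\<close>

lemma upper_half_plane_iff: "z \<in> upper_half_plane \<longleftrightarrow> Im z > 0"
  by (simp add: upper_half_plane_def)

lemma Im_minus_inverse_pos: "Im z > 0 \<Longrightarrow> Im (- 1 / z) > 0"
  by (simp add: Im_divide divide_pos_pos add_nonneg_pos)

lemma moebius_act_S: "moebius_act (vector [vector [0, -1], vector [1, 0]]) z = - 1 / z"
  by (simp add: moebius_act_def aut_denom_def)

lemma moebius_act_T:
  "moebius_act (vector [vector [1, hecke_width \<mu>], vector [0, 1]]) z = z + of_real (hecke_width \<mu>)"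
  by (simp add: moebius_act_def aut_denom_def)

lemma hecke_q_add_width:
  assumes "\<mu> \<ge> 3"
  shows "hecke_q \<mu> (z + of_real (hecke_width \<mu>)) = hecke_q \<mu> z"
proof -
  have "2 * of_real pi * \<i> * (z + of_real (hecke_width \<mu>)) / of_real (hecke_width \<mu>) =
      2 * of_real pi * \<i> * z / of_real (hecke_width \<mu>) + 2 * of_real pi * \<i>"
    using hecke_width_pos[OF assms] by (simp add: field_simps)
  then show ?thesis by (simp add: hecke_q_def exp_add)
qed

lemma hecke_q_nonzero [simp]: "hecke_q \<mu> z \<noteq> 0"
  by (simp add: hecke_q_def)

lemma norm_hecke_q: "norm (hecke_q \<mu> z) = exp (- 2 * pi * Im z / hecke_width \<mu>)"
  by (simp add: hecke_q_def Re_divide_of_real)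

lemma norm_hecke_q_less_1:
  assumes "\<mu> \<ge> 3" "z \<in> upper_half_plane"
  shows "norm (hecke_q \<mu> z) < 1"
  using hecke_width_pos[OF assms(1)] assms(2)
  by (simp add: norm_hecke_q upper_half_plane_iff)

text \<open>An explicit preimage under q from the principal logarithm; the formula for its imaginary
  part shows that it lies in the half plane when the norm of x is below 1.\<close>

lemma hecke_q_surj:
  assumes "\<mu> \<ge> 3" "x \<noteq> 0"
  shows "hecke_q \<mu> (of_real (hecke_width \<mu>) / (2 * of_real pi * \<i>) * Ln x) = x"
    and "Im (of_real (hecke_width \<mu>) / (2 * of_real pi * \<i>) * Ln x) = - hecke_width \<mu> / (2 * pi) * ln (norm x)"
proof -
  have "2 * of_real pi * \<i> * (of_real (hecke_width \<mu>) / (2 * of_real pi * \<i>) * Ln x) /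
      of_real (hecke_width \<mu>) = Ln x"
    using hecke_width_pos[OF assms(1)] by simp
  then show "hecke_q \<mu> (of_real (hecke_width \<mu>) / (2 * of_real pi * \<i>) * Ln x) = x"
    unfolding hecke_q_def using assms(2) by (metis exp_Ln)
  have aux: "Im (of_real a * (- \<i> * Ln x)) = a * - ln (norm x)" for a
    using assms(2) by simp
  have "of_real (hecke_width \<mu>) / (2 * of_real pi * \<i>) * Ln x =
      of_real (hecke_width \<mu> / (2 * pi)) * (- \<i> * Ln x)"
    using hecke_width_pos[OF assms(1)] by (simp add: field_simps)
  then show "Im (of_real (hecke_width \<mu>) / (2 * of_real pi * \<i>) * Ln x) =
      - hecke_width \<mu> / (2 * pi) * ln (norm x)"
    by (simp only: aux)
qed

lemma has_field_derivative_hecke_q: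
  "(hecke_q \<mu> has_field_derivative
     2 * of_real pi * \<i> / of_real (hecke_width \<mu>) * hecke_q \<mu> z) (at z within A)"
proof -
  have "((\<lambda>z. exp (c * z)) has_field_derivative c * exp (c * z)) (at z within A)" for c
    by (auto intro!: derivative_eq_intros)
  moreover have "hecke_q \<mu> = (\<lambda>z. exp (2 * of_real pi * \<i> / of_real (hecke_width \<mu>) * z))"
    by (simp add: hecke_q_def fun_eq_iff)
  ultimately show ?thesis by (simp only:)
qed

lemma hecke_vertex_eq_cis:
  assumes "\<mu> \<ge> 3"
  shows "hecke_vertex \<mu> = exp (\<i> * of_real (pi - pi / real \<mu>))"
proof -
  have "exp (\<i> * of_real (pi - pi / real \<mu>)) =
      exp (\<i> * of_real pi) * exp (- (of_real pi * \<i> / of_nat \<mu>))"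
    by (subst exp_add[symmetric]) (simp add: algebra_simps)
  then show ?thesis by (simp add: hecke_vertex_def)
qed

lemma hecke_vertex_Re_Im:
  assumes "\<mu> \<ge> 3"
  shows "Re (hecke_vertex \<mu>) = - cos (pi / real \<mu>)" "Im (hecke_vertex \<mu>) = sin (pi / real \<mu>)"
  unfolding hecke_vertex_eq_cis[OF assms] by (simp_all add: Re_exp Im_exp)

lemma Ln_hecke_vertex:
  assumes "\<mu> \<ge> 3"
  shows "Ln (hecke_vertex \<mu>) = \<i> * of_real (pi - pi / real \<mu>)"
proof -
  have "0 < pi / real \<mu>"
    using assms by simp
  moreover have "pi / real \<mu> \<le> pi / 3"
    using assms by (intro divide_left_mono) auto
  ultimately have "- pi < pi - pi / real \<mu>" "pi - pi / real \<mu> \<le> pi"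
    using pi_gt_zero by linarith+
  then show ?thesis unfolding hecke_vertex_eq_cis[OF assms]
    by (intro Ln_exp) simp_all
qed

lemma hecke_vertex_in_upper_half_plane: "\<mu> \<ge> 3 \<Longrightarrow> hecke_vertex \<mu> \<in> upper_half_plane"
  by (simp add: upper_half_plane_iff hecke_vertex_Re_Im sin_gt_zero divide_less_eq)

lemma norm_hecke_vertex: "norm (hecke_vertex \<mu>) = 1"
  by (simp add: hecke_vertex_def)

text \<open>On the unit circle -1/z is -cnj z, and the vertex has real part minus half the width. So
  the vertex is fixed by S followed by the inverse of T, the elliptic element of order
  \<mu>.\<close>

lemma minus_inverse_hecke_vertex:
  assumes "\<mu> \<ge> 3"
  shows "- 1 / hecke_vertex \<mu> = hecke_vertex \<mu> + of_real (hecke_width \<mu>)"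
proof -
  have "hecke_vertex \<mu> * cnj (hecke_vertex \<mu>) = 1"
    using norm_hecke_vertex[of \<mu>] by (simp flip: complex_norm_square)
  moreover have "hecke_vertex \<mu> \<noteq> 0" by (simp add: hecke_vertex_def)
  ultimately have "- 1 / hecke_vertex \<mu> = - cnj (hecke_vertex \<mu>)"
    by (simp add: field_simps)
  also have "\<dots> = hecke_vertex \<mu> + of_real (hecke_width \<mu>)"
    using assms by (simp add: complex_eq_iff hecke_vertex_Re_Im hecke_width_def)
  finally show ?thesis .
qed

text \<open>
  The transformation of a primitive under \<open>S\<close> contains an unknown multiple of \<open>Ln z\<close>. It is
  determined by evaluation at the vertex, where \<open>S\<close> acts like \<open>T\<close>.
\<close>

lemma hecke_E2_primitive:
  assumes \<mu>: "\<mu> \<ge> 3" and E2: "is_hecke_E2 \<mu> E2"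
  obtains M L where "M holomorphic_on ball 0 1" "M 0 = 0"
    and "\<And>z. L z = 2 * of_real pi * \<i> * z / of_real (hecke_width \<mu>) + M (hecke_q \<mu> z)"
    and "\<And>z. z \<in> upper_half_plane \<Longrightarrow>
      (L has_field_derivative 2 * of_real pi * \<i> / of_real (hecke_width \<mu>) * E2 z) (at z)"
    and "\<And>z. z \<in> upper_half_plane \<Longrightarrow>
      L (- 1 / z) = L z + 4 * of_nat \<mu> / (of_nat \<mu> - 2) * (Ln z - \<i> * of_real pi / 2)"
proof -
  define t where "t = 2 * of_real pi * \<i> / complex_of_real (hecke_width \<mu>)"
  have t: "t \<noteq> 0" "of_real (hecke_width \<mu>) \<noteq> (0 :: complex)"
    using hecke_width_pos[OF \<mu>] by (auto simp: t_def)
  from E2 obtain e C where e0: "e 0 = 1" and e: "has_q_expansion \<mu> E2 e"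
    and C: "\<And>A z. A \<in> hecke_group \<mu> \<Longrightarrow> z \<in> upper_half_plane \<Longrightarrow>
      E2 (moebius_act A z) / aut_denom A z ^ 2 = E2 z + C * of_real (A $ 2 $ 1) / aut_denom A z"
    unfolding is_hecke_E2_def by blast
  \<comment> \<open>The expansion is given at points z only. Every x with 0 < norm x < 1 is the q of
    such a point, so the power series converges in the whole unit disc.\<close>
  have summ: "summable (\<lambda>n. e n * x ^ n)" if x: "norm x < 1" for x
  proof (cases "x = 0")
    case False
    define z where "z = of_real (hecke_width \<mu>) / (2 * of_real pi * \<i>) * Ln x"
    have "z \<in> upper_half_plane" "hecke_q \<mu> z = x"
      using hecke_q_surj[OF \<mu> False] hecke_width_pos[OF \<mu>] x False
      unfolding z_def upper_half_plane_iff by (auto simp: mult_pos_neg divide_neg_pos)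
    then show ?thesis
      using e by (auto simp: has_q_expansion_def sums_iff)
  qed (auto intro!: summable_finite[of "{0}"])
  \<comment> \<open>As a function of q, f is (E2 - 1) / q. A primitive M of f in the disc gives d/dz
    M(q) = t (E2 - 1), and the constant term 1 of E2 contributes t z to L.\<close>
  define f where "f x = (\<Sum>n. e (Suc n) * x ^ n)" for x
  have summ': "summable (\<lambda>n. e (Suc n) * x ^ n)" if x: "norm x < 1" for x
  proof (cases "x = 0")
    case False
    have "summable (\<lambda>n. inverse x * (e (Suc n) * x ^ Suc n))"
      using summ[OF x] by (intro summable_mult) (subst summable_Suc_iff)
    then show ?thesis using False by (simp add: field_simps)
  qed (auto intro!: summable_finite[of "{0}"])
  have holf: "f holomorphic_on ball 0 1"
    using summ' by (intro power_series_holomorphic[where a = "\<lambda>n. e (Suc n)"])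
      (auto simp: f_def intro!: summable_sums)
  obtain M0 where M0: "\<And>x. x \<in> ball 0 1 \<Longrightarrow> (M0 has_field_derivative f x) (at x within ball 0 1)"
    using holomorphic_convex_primitive'[OF convex_ball open_ball holf] by blast
  define M where "M x = M0 x - M0 0" for x
  have M: "(M has_field_derivative f x) (at x)" if "x \<in> ball 0 1" for x
    using M0[OF that] at_within_open[OF that open_ball] unfolding M_def
    by (auto intro!: derivative_eq_intros)
  define L where "L z = t * z + M (hecke_q \<mu> z)" for z
  have E2eq: "E2 z = 1 + hecke_q \<mu> z * f (hecke_q \<mu> z)" if z: "z \<in> upper_half_plane" for z
  proof -
    have q: "norm (hecke_q \<mu> z) < 1" using norm_hecke_q_less_1[OF \<mu> z] .
    have "E2 z = (\<Sum>n. e n * hecke_q \<mu> z ^ n)"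
      using e z by (auto simp: has_q_expansion_def sums_iff)
    also have "\<dots> = e 0 * hecke_q \<mu> z ^ 0 + (\<Sum>n. e (Suc n) * hecke_q \<mu> z ^ Suc n)"
      using suminf_split_head[OF summ[OF q]] by simp
    also have "(\<Sum>n. e (Suc n) * hecke_q \<mu> z ^ Suc n) = hecke_q \<mu> z * f (hecke_q \<mu> z)"
      using suminf_mult[OF summ'[OF q], of "hecke_q \<mu> z"] by (simp add: f_def algebra_simps)
    finally show ?thesis using e0 by simp
  qed
  have L: "(L has_field_derivative t * E2 z) (at z)" if z: "z \<in> upper_half_plane" for z
  proof -
    have "((\<lambda>z. M (hecke_q \<mu> z)) has_field_derivative f (hecke_q \<mu> z) * (t * hecke_q \<mu> z)) (at z)"
      unfolding t_def
      using norm_hecke_q_less_1[OF \<mu> z] by (intro DERIV_chain2[OF M has_field_derivative_hecke_q]) auto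
    then show ?thesis
      unfolding L_def E2eq[OF z] by (auto intro!: derivative_eq_intros simp: algebra_simps)
  qed
  have S: "E2 (- 1 / z) / z ^ 2 = E2 z + C / z" if "z \<in> upper_half_plane" for z
    using C[OF hecke_group.S that] unfolding moebius_act_S by (simp add: aut_denom_def)
  have "((\<lambda>z. L (- 1 / z) - L z - t * C * Ln z) has_field_derivative 0) (at z)"
    if z: "z \<in> upper_half_plane" for z
  proof -
    have z': "- 1 / z \<in> upper_half_plane" "z \<noteq> 0" "z \<notin> \<real>\<^sub>\<le>\<^sub>0"
      using z Im_minus_inverse_pos[of z]
      by (auto simp: upper_half_plane_iff complex_nonpos_Reals_iff)
    have "((\<lambda>z. - 1 / z) has_field_derivative 1 / z ^ 2) (at z)"
      using z' by (auto intro!: derivative_eq_intros simp: power2_eq_square)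
    from DERIV_chain2[OF L[OF z'(1)] this]
    have "((\<lambda>z. L (- 1 / z)) has_field_derivative t * (E2 (- 1 / z) / z ^ 2)) (at z)" by simp
    then show ?thesis
      using z' L[OF z] unfolding S[OF z]
      by (auto intro!: derivative_eq_intros simp: field_simps)
  qed
  from has_field_derivative_zero_imp_const[OF this]
  obtain c where "\<And>z. z \<in> upper_half_plane \<Longrightarrow> L (- 1 / z) - L z - t * C * Ln z = c" by blast
  then have c: "L (- 1 / z) = L z + t * C * Ln z + c" if "z \<in> upper_half_plane" for z
    using that by (simp add: algebra_simps)
  \<comment> \<open>S fixes \<i>, so the two values of L cancel there and c is minus t C Ln
    \<i>.\<close>
  have ci: "c = - (t * C * (\<i> * of_real pi / 2))"
    using c[of \<i>] by (simp add: eq_neg_iff_add_eq_0 add.commute)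
  have "L (hecke_vertex \<mu> + of_real (hecke_width \<mu>)) = L (hecke_vertex \<mu>) + 2 * of_real pi * \<i>"
    using t(2) by (simp add: L_def hecke_q_add_width[OF \<mu>] t_def field_simps)
  with c[OF hecke_vertex_in_upper_half_plane[OF \<mu>]]
  have "t * C * Ln (hecke_vertex \<mu>) + c = 2 * of_real pi * \<i>"
    unfolding minus_inverse_hecke_vertex[OF \<mu>] by (simp add: algebra_simps)
  then have "t * C * (\<i> * of_real (pi - pi / real \<mu>) - \<i> * of_real pi / 2) = 2 * of_real pi * \<i>"
    unfolding Ln_hecke_vertex[OF \<mu>] ci by (simp only: right_diff_distrib add_uminus_conv_diff)
  \<comment> \<open>The arguments of the vertex and of \<i> differ by \<pi>/2 - \<pi>/\<mu>. This
    angle is the source of the constant 4\<mu> / (\<mu> - 2), and T contributes the 2\<pi>\<i> on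
    the other side.\<close>
  moreover have "\<i> * of_real (pi - pi / real \<mu>) - \<i> * of_real pi / 2 =
      of_real pi * \<i> * ((of_nat \<mu> - 2) / (2 * of_nat \<mu>))"
    using \<mu> by (simp add: field_simps)
  ultimately have "of_real pi * \<i> * (t * C * ((of_nat \<mu> - 2) / (2 * of_nat \<mu>))) = of_real pi * \<i> * 2"
    by (simp only: ac_simps)
  then have "t * C * ((of_nat \<mu> - 2) / (2 * of_nat \<mu>)) = 2"
    by (subst (asm) mult_cancel_left) auto
  moreover have "(of_nat \<mu> - 2 :: complex) \<noteq> 0"
    using \<mu> of_nat_eq_iff[of \<mu> 2, where ?'a = complex] by simp
  ultimately have tC: "t * C = 4 * of_nat \<mu> / (of_nat \<mu> - 2)"
    using \<mu> by (simp add: field_simps)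
  have "L (- 1 / z) = L z + 4 * of_nat \<mu> / (of_nat \<mu> - 2) * (Ln z - \<i> * of_real pi / 2)"
    if "z \<in> upper_half_plane" for z
    using c[OF that] unfolding ci tC[symmetric] by (simp only: right_diff_distrib) simp
  with L show ?thesis unfolding t_def
  proof (intro that[of M L])
    show "M holomorphic_on ball 0 1"
      using M holomorphic_on_open[OF open_ball] by blast
  qed (auto simp: M_def L_def t_def)
qed

section \<open>The hauptmodul on the closed triangle\<close>

text \<open>To first order U multiplies z - p by \<zeta>. Dividing (U z - p)^n g(U z) = (z - p)^n
  g(z) by (z - p)^n and letting z tend to p compares leading coefficients: \<zeta>^n g(p) = g(p).
  Applied to elliptic elements, this restricts zero orders to multiples of the order of
  \<zeta>.\<close>

lemma invariant_zero_order:
  assumes f: "f holomorphic_on S" and S: "open S" "connected S" "p \<in> S"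
    and "f p = 0" and nonconst: "\<not> f constant_on S"
    and U: "U p = p" "(U has_field_derivative \<zeta>) (at p)"
    and inv: "\<And>z. z \<in> S \<Longrightarrow> f (U z) = f z"
  obtains g r n where "0 < n" "0 < r" "ball p r \<subseteq> S" "g holomorphic_on ball p r"
    "\<And>w. w \<in> ball p r \<Longrightarrow> f w = (w - p) ^ n * g w"
    "\<And>w. w \<in> ball p r \<Longrightarrow> g w \<noteq> 0" "\<zeta> ^ n = 1"
proof -
  obtain g r n where g: "0 < n" "0 < r" "ball p r \<subseteq> S" "g holomorphic_on ball p r"
    "\<And>w. w \<in> ball p r \<Longrightarrow> f w = (w - p) ^ n * g w"
    "\<And>w. w \<in> ball p r \<Longrightarrow> g w \<noteq> 0"
    using holomorphic_factor_zero_nonconstant[OF f S(1,2) S(3) \<open>f p = 0\<close> nonconst] by metis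
  have contg: "isCont g p"
    using g(2,4) holomorphic_on_imp_continuous_on[OF g(4)] continuous_on_interior by fastforce
  have contU: "isCont U p"
    using U(2) DERIV_isCont by blast
  have "((\<lambda>z. ((U z - p) / (z - p)) ^ n * g (U z)) \<longlongrightarrow> \<zeta> ^ n * g p) (at p)"
  proof (intro tendsto_intros)
    show "((\<lambda>z. (U z - p) / (z - p)) \<longlongrightarrow> \<zeta>) (at p)"
      using U by (simp add: has_field_derivative_iff)
    show "((\<lambda>z. g (U z)) \<longlongrightarrow> g p) (at p)"
      using isCont_o2[OF contU, of g] contg U(1) by (simp add: isCont_def)
  qed
  moreover have "\<forall>\<^sub>F z in at p. ((U z - p) / (z - p)) ^ n * g (U z) = g z"
  proof -
    have "\<forall>\<^sub>F z in at p. U z \<in> ball p r"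
      using contU U(1) g(2) unfolding isCont_def
      by (intro topological_tendstoD[where S = "ball p r"]) auto
    moreover have "\<forall>\<^sub>F z in at p. z \<in> ball p r - {p}"
      using g(2) by (intro eventually_at_in_open) auto
    ultimately show ?thesis
    proof eventually_elim
      case (elim z)
      then have "(U z - p) ^ n * g (U z) = (z - p) ^ n * g z"
        using g(5)[of z] g(5)[of "U z"] inv[of z] g(3) by auto
      then show ?case using elim by (simp add: field_simps power_divide)
    qed
  qed
  ultimately have "(g \<longlongrightarrow> \<zeta> ^ n * g p) (at p)"
    by (rule Lim_transform_eventually)
  moreover have "(g \<longlongrightarrow> g p) (at p)" using contg by (simp add: isCont_def)
  ultimately have "\<zeta> ^ n * g p = g p" by (intro tendsto_unique[of "at p"]) auto
  moreover have "g p \<noteq> 0" using g(2,6) by simp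
  ultimately have "\<zeta> ^ n = 1" by simp
  with g show ?thesis using that by blast
qed

text \<open>Since f' = (z - p)^(n-1) (n g + (z - p) g'), the quotient has order a (n-1) - b n at p.
  The inequality \<open>ab\<close> makes this nonnegative, so the natural-number subtraction in h is
  exact.\<close>

lemma tendsto_deriv_power_quotient:
  fixes f :: "complex \<Rightarrow> complex"
  assumes r: "0 < r" and g: "g holomorphic_on ball p r"
    and f: "\<And>w. w \<in> ball p r \<Longrightarrow> f w = (w - p) ^ n * g w"
    and nz: "\<And>w. w \<in> ball p r \<Longrightarrow> g w \<noteq> 0"
    and n: "0 < n" and ab: "b * n \<le> a * (n - 1)"
  obtains l where "((\<lambda>z. deriv f z ^ a / f z ^ b) \<longlongrightarrow> l) (at p)"
proof -
  define h where "h z = (z - p) ^ (a * (n - 1) - b * n) *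
    ((of_nat n * g z + (z - p) * deriv g z) ^ a / g z ^ b)" for z
  have "h holomorphic_on ball p r"
    unfolding h_def using g nz by (auto intro!: holomorphic_intros)
  then have "isCont h p"
    using r holomorphic_on_imp_continuous_on continuous_on_interior by fastforce
  then have "(h \<longlongrightarrow> h p) (at p)" by (simp add: isCont_def)
  moreover have "\<forall>\<^sub>F z in at p. h z = deriv f z ^ a / f z ^ b"
  proof -
    have "\<forall>\<^sub>F z in at p. z \<in> ball p r - {p}"
      using r by (intro eventually_at_in_open) auto
    then show ?thesis
    proof eventually_elim
      case (elim z)
      have "((\<lambda>w. (w - p) ^ n * g w) has_field_derivative
          of_nat n * (z - p) ^ (n - 1) * g z + (z - p) ^ n * deriv g z) (at z)"
        using elim holomorphic_derivI[OF g open_ball, of z]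
        by (auto intro!: derivative_eq_intros)
      then have "(f has_field_derivative
          of_nat n * (z - p) ^ (n - 1) * g z + (z - p) ^ n * deriv g z) (at z)"
        by (rule DERIV_cong_ev[THEN iffD1, rotated -1])
          (use elim f eventually_nhds_in_open[of "ball p r" z] in \<open>auto elim!: eventually_mono\<close>)
      then have "deriv f z = of_nat n * (z - p) ^ (n - 1) * g z + (z - p) ^ n * deriv g z"
        by (rule DERIV_imp_deriv)
      also have "(z - p) ^ n = (z - p) ^ (n - 1) * (z - p)"
        using n by (metis power_minus_mult)
      finally have "deriv f z = (z - p) ^ (n - 1) * (of_nat n * g z + (z - p) * deriv g z)"
        by (simp add: algebra_simps)
      then have "deriv f z ^ a / f z ^ b = (z - p) ^ (a * (n - 1)) / (z - p) ^ (b * n) *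
          ((of_nat n * g z + (z - p) * deriv g z) ^ a / g z ^ b)"
        using f[of z] elim by (simp add: power_mult_distrib power_mult[symmetric] mult.commute)
      also have "(z - p) ^ (a * (n - 1)) / (z - p) ^ (b * n) = (z - p) ^ (a * (n - 1) - b * n)"
        using elim ab by (simp add: power_diff)
      finally show ?case by (simp add: h_def)
    qed
  qed
  ultimately have "((\<lambda>z. deriv f z ^ a / f z ^ b) \<longlongrightarrow> h p) (at p)"
    by (rule Lim_transform_eventually)
  then show ?thesis using that by blast
qed

section \<open>The hyperbolic triangle and the boundary values of the hauptmodul\<close>

lemma hecke_triangle_iff:
  assumes "\<mu> \<ge> 3"
  shows "z \<in> hecke_triangle \<mu> \<longleftrightarrow>
    Im z > 0 \<and> - hecke_width \<mu> / 2 < Re z \<and> Re z < 0 \<and> norm z > 1"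
  using assms by (simp add: hecke_triangle_def hecke_vertex_Re_Im hecke_width_def)

lemma open_hecke_triangle: "open (hecke_triangle \<mu>)"
proof -
  have "hecke_triangle \<mu> = {z. Im z > 0} \<inter> {z. Re z > Re (hecke_vertex \<mu>)} \<inter> {z. Re z < 0} \<inter> - cball 0 1"
    by (auto simp: hecke_triangle_def)
  then show ?thesis
    by (simp only:) (intro open_Int open_halfspace_Im_gt open_halfspace_Re_gt open_halfspace_Re_lt, auto)
qed

lemma hecke_triangle_subset: "hecke_triangle \<mu> \<subseteq> upper_half_plane"
  by (auto simp: hecke_triangle_def upper_half_plane_def)

locale hecke_hauptmodul =
  fixes \<mu> :: nat and J :: "complex \<Rightarrow> complex"
  assumes mu: "\<mu> \<ge> 3" and hauptmodul: "is_hecke_hauptmodul \<mu> J"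
begin

lemma holomorphic_J: "J holomorphic_on upper_half_plane"
  using hauptmodul by (simp add: is_hecke_hauptmodul_def)

lemma isCont_J: "z \<in> upper_half_plane \<Longrightarrow> isCont J z"
  using holomorphic_on_imp_continuous_on[OF holomorphic_J] open_upper_half_plane
  by (simp add: continuous_on_eq_continuous_at)

lemma J_invariant: "A \<in> hecke_group \<mu> \<Longrightarrow> z \<in> upper_half_plane \<Longrightarrow> J (moebius_act A z) = J z"
  using hauptmodul by (simp add: is_hecke_hauptmodul_def)

lemma J_S: "z \<in> upper_half_plane \<Longrightarrow> J (- 1 / z) = J z"
  using J_invariant[OF hecke_group.S] unfolding moebius_act_S .

lemma J_T: "z \<in> upper_half_plane \<Longrightarrow> J (z + of_real (hecke_width \<mu>)) = J z"
  using J_invariant[OF hecke_group.T] unfolding moebius_act_T .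

lemma J_i [simp]: "J \<i> = 1" and J_vertex [simp]: "J (hecke_vertex \<mu>) = 0"
  using hauptmodul by (simp_all add: is_hecke_hauptmodul_def)

lemma J_inj: "inj_on J (hecke_triangle \<mu>)"
  and J_image: "J ` hecke_triangle \<mu> = upper_half_plane"
  using hauptmodul by (auto simp: is_hecke_hauptmodul_def bij_betw_def)

lemma J_not_constant: "\<not> J constant_on upper_half_plane"
  using hecke_vertex_in_upper_half_plane[OF mu] J_i J_vertex
  by (metis constant_on_def ii_in_upper_half_plane zero_neq_one)

lemma open_J_image: "open U \<Longrightarrow> U \<subseteq> upper_half_plane \<Longrightarrow> open (J ` U)"
  using open_mapping_thm[OF holomorphic_J open_upper_half_plane connected_upper_half_plane _ _ J_not_constant] .

text \<open>The hypothesis \<open>approx\<close> puts p in the closure of the triangle, in the form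
  in which explicit nearby points verify it.\<close>

lemma approx_J:
  assumes p: "p \<in> upper_half_plane" and V: "open V" "J p \<in> V"
    and approx: "\<And>e. e > 0 \<Longrightarrow> \<exists>z\<in>hecke_triangle \<mu>. dist z p < e" and "\<epsilon> > 0"
  obtains z where "z \<in> hecke_triangle \<mu>" "dist z p < \<epsilon>" "J z \<in> V"
proof -
  have "\<forall>\<^sub>F z in nhds p. J z \<in> V"
    using isCont_J[OF p] V by (auto simp: isCont_def tendsto_at_iff_tendsto_nhds dest: topological_tendstoD)
  then obtain d where "d > 0" "\<And>z. dist z p < d \<Longrightarrow> J z \<in> V"
    by (auto simp: eventually_nhds_metric)
  with approx[of "min d \<epsilon>"] \<open>\<epsilon> > 0\<close> that show ?thesis by auto
qed

text \<open>A boundary point cannot go to the lower half plane, by continuity. If it went to the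
  upper half plane, its value would also be taken at some d in the triangle; the image of a small
  disc around d is open and contains J z for triangle points z close to p. With radius half the
  distance from d to p, this contradicts injectivity.\<close>

lemma J_boundary_real:
  assumes p: "p \<in> upper_half_plane" "p \<notin> hecke_triangle \<mu>"
    and approx: "\<And>e. e > 0 \<Longrightarrow> \<exists>z\<in>hecke_triangle \<mu>. dist z p < e"
  shows "Im (J p) = 0"
proof (rule ccontr)
  assume "Im (J p) \<noteq> 0"
  then consider "Im (J p) < 0" | "Im (J p) > 0" by linarith
  then show False
  proof cases
    case 1
    with open_halfspace_Im_lt[of 0] have "open {z. Im z < 0}" "J p \<in> {z. Im z < 0}" by auto
    then obtain z where "z \<in> hecke_triangle \<mu>" "Im (J z) < 0"
      using approx_J[OF p(1) _ _ approx, of "{z. Im z < 0}" 1] by auto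
    then show False using J_image by (force simp: upper_half_plane_iff)
  next
    case 2
    then obtain d where d: "d \<in> hecke_triangle \<mu>" "J d = J p"
      using J_image by (force simp: upper_half_plane_iff image_iff)
    define \<delta> where "\<delta> = dist d p / 2"
    have \<delta>: "\<delta> > 0" using d p by (auto simp: \<delta>_def)
    define U where "U = hecke_triangle \<mu> \<inter> ball d \<delta>"
    have "open (J ` U)"
      using hecke_triangle_subset open_hecke_triangle by (intro open_J_image) (auto simp: U_def)
    moreover have "J p \<in> J ` U"
      using d \<delta> by (auto simp: U_def image_iff intro!: bexI[of _ d])
    ultimately obtain z where z: "z \<in> hecke_triangle \<mu>" "dist z p < \<delta>" "J z \<in> J ` U"
      using approx_J[OF p(1) _ _ approx \<delta>] by metis
    then obtain u where u: "u \<in> U" "J u = J z" by auto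
    then have "z = u"
      using z(1) by (intro inj_onD[OF J_inj, of z u]) (auto simp: U_def)
    with u have "z \<in> U" by simp
    then have "dist d p < \<delta> + \<delta>"
      using z(2) dist_triangle_less_add[of d z \<delta> p \<delta>] by (auto simp: U_def dist_commute)
    then show False by (simp add: \<delta>_def)
  qed
qed

lemma J_imag_axis_real:
  assumes "y > 1"
  shows "Im (J (\<i> * of_real y)) = 0"
proof (rule J_boundary_real)
  show "\<exists>z\<in>hecke_triangle \<mu>. dist z (\<i> * of_real y) < e" if "e > 0" for e
  proof
    define t where "t = min (e / 2) (hecke_width \<mu> / 4)"
    have t: "t > 0" "t < e" "t < hecke_width \<mu> / 2"
      using that hecke_width_pos[OF mu] by (auto simp: t_def)
    let ?z = "\<i> * of_real y - of_real t"
    have "norm ?z \<ge> \<bar>Im ?z\<bar>" by (rule abs_Im_le_cmod)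
    then show "?z \<in> hecke_triangle \<mu>"
      using t assms by (simp add: hecke_triangle_iff[OF mu])
    show "dist ?z (\<i> * of_real y) < e" using t by (simp add: dist_norm)
  qed
qed (use assms in \<open>auto simp: upper_half_plane_iff hecke_triangle_iff[OF mu]\<close>)

text \<open>Schwarz reflection in the imaginary axis: the conjugated function is holomorphic and
  agrees with J on the axis above \<i>, where J is real, so the identity theorem applies.\<close>

lemma J_minus_cnj:
  assumes "z \<in> upper_half_plane"
  shows "J (- cnj z) = cnj (J z)"
proof -
  have hol: "(\<lambda>z. cnj (J (- cnj z))) holomorphic_on upper_half_plane"
  proof -
    have img: "(\<lambda>z. - z) ` (cnj ` upper_half_plane) = upper_half_plane"
      by (force simp: upper_half_plane_iff image_iff intro!: bexI[of _ "- cnj _"])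
    have "(\<lambda>z. J (- z)) holomorphic_on cnj ` upper_half_plane"
      using holomorphic_on_compose[of uminus "cnj ` upper_half_plane" J] holomorphic_J
      unfolding img by (simp add: o_def holomorphic_intros)
    from holomorphic_on_compose_cnj_cnj[OF this open_upper_half_plane] show ?thesis
      by (simp add: o_def)
  qed
  have "cnj (J (- cnj z)) - J z = 0"
  proof (rule analytic_continuation[OF _ open_upper_half_plane connected_upper_half_plane _ _ _ _ assms,
        where U = "(\<lambda>y. \<i> * of_real y) ` {1<..}" and \<xi> = "2 * \<i>"])
    show "(\<lambda>z. cnj (J (- cnj z)) - J z) holomorphic_on upper_half_plane"
      using hol holomorphic_J by (intro holomorphic_intros)
    show "2 * \<i> islimpt (\<lambda>y. \<i> * of_real y) ` {1<..}"
      unfolding islimpt_approachable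
    proof (intro allI impI)
      fix e :: real assume "e > 0"
      then show "\<exists>x'\<in>(\<lambda>y. \<i> * of_real y) ` {1<..}. x' \<noteq> 2 * \<i> \<and> dist x' (2 * \<i>) < e"
        by (intro bexI[of _ "\<i> * of_real (2 + e / 2)"])
          (auto simp: dist_norm norm_mult algebra_simps complex_eq_iff)
    qed
  qed (auto simp: upper_half_plane_iff J_imag_axis_real complex_eq_iff)
  then show ?thesis by (metis complex_cnj_cnj eq_iff_diff_eq_0)
qed

text \<open>Reflection in the unit circle, as S composed with the reflection in the imaginary axis.
  Composition with T gives the reflection in the third side in the same way.\<close>

lemma J_inverse_cnj:
  assumes "z \<in> upper_half_plane"
  shows "J (1 / cnj z) = cnj (J z)"
  using J_S[of "- cnj z"] J_minus_cnj[OF assms] assms by (simp add: upper_half_plane_iff)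

lemma J_reflect_width:
  assumes "z \<in> upper_half_plane"
  shows "J (- of_real (hecke_width \<mu>) - cnj z) = cnj (J z)"
  using J_T[of "- of_real (hecke_width \<mu>) - cnj z"] J_minus_cnj[OF assms] assms
  by (simp add: upper_half_plane_iff)

text \<open>
  Two boundary points of the triangle with the same value of \<open>J\<close>, the first one in the interior
  of a side: an open neighbourhood of the first covers \<open>J z'\<close> for some \<open>z'\<close> of the triangle close to the
  second, and on this neighbourhood only points of the triangle are mapped to the upper half plane.
\<close>

lemma J_neq_of_reflection:
  assumes "p \<in> N" "open N" "N \<subseteq> upper_half_plane" and q: "q \<in> upper_half_plane" and "p \<noteq> q"
    and approx: "\<And>e. e > 0 \<Longrightarrow> \<exists>z\<in>hecke_triangle \<mu>. dist z q < e"
    and \<sigma>: "\<And>z. z \<in> N \<Longrightarrow> J (\<sigma> z) = cnj (J z)"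
    and cases: "\<And>z. z \<in> N \<Longrightarrow> z \<in> hecke_triangle \<mu> \<or> \<sigma> z \<in> hecke_triangle \<mu> \<or> \<sigma> z = z"
  shows "J p \<noteq> J q"
proof
  assume eq: "J p = J q"
  define \<delta> where "\<delta> = dist p q / 2"
  have \<delta>: "\<delta> > 0" using \<open>p \<noteq> q\<close> by (simp add: \<delta>_def)
  define N' where "N' = N \<inter> ball p \<delta>"
  have "open (J ` N')"
    using assms(2,3) by (intro open_J_image) (auto simp: N'_def)
  moreover have "J q \<in> J ` N'"
    using assms(1) \<delta> eq by (auto simp: N'_def image_iff intro!: bexI[of _ p])
  ultimately obtain z' where z': "z' \<in> hecke_triangle \<mu>" "dist z' q < \<delta>" "J z' \<in> J ` N'"
    using approx_J[OF q _ _ approx \<delta>] by metis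
  then obtain z where z: "z \<in> N" "dist p z < \<delta>" "J z = J z'"
    by (auto simp: N'_def)
  have "Im (J z) > 0" using z(3) z'(1) J_image by (auto simp: upper_half_plane_iff)
  from cases[OF z(1)] show False
  proof (elim disjE)
    assume "z \<in> hecke_triangle \<mu>"
    then have "z = z'" using z z' inj_onD[OF J_inj] by blast
    then have "dist p q < \<delta> + \<delta>"
      using z z' dist_triangle_less_add[of p z \<delta> q \<delta>] by (auto simp: dist_commute)
    then show False by (simp add: \<delta>_def)
  next
    assume "\<sigma> z \<in> hecke_triangle \<mu>"
    then have "Im (J (\<sigma> z)) > 0" using J_image by (auto simp: upper_half_plane_iff)
    then show False using \<sigma>[OF z(1)] \<open>Im (J z) > 0\<close> by simp
  next
    assume "\<sigma> z = z"
    then have "J z = cnj (J z)" using \<sigma>[OF z(1)] by simp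
    then show False using \<open>Im (J z) > 0\<close> by (simp add: complex_eq_iff)
  qed
qed

section \<open>The corners of the triangle and the values 0 and 1 on its closure\<close>

lemma hecke_width_less_2: "hecke_width \<mu> < 2"
proof -
  have "cos (pi / real \<mu>) < cos 0"
    using mu by (intro cos_monotone_0_pi) (auto simp: divide_le_eq)
  then show ?thesis by (simp add: hecke_width_def)
qed

lemma approx_i:
  assumes "e > 0"
  shows "\<exists>z\<in>hecke_triangle \<mu>. dist z \<i> < e"
proof
  define t where "t = min (e / 4) (hecke_width \<mu> / 4)"
  have t: "t > 0" "2 * t < e" "t < hecke_width \<mu> / 2"
    using assms hecke_width_pos[OF mu] by (auto simp: t_def)
  have "norm (Complex (- t) (1 + t)) \<ge> \<bar>Im (Complex (- t) (1 + t))\<bar>" by (rule abs_Im_le_cmod)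
  then show "Complex (- t) (1 + t) \<in> hecke_triangle \<mu>"
    using t by (simp add: hecke_triangle_iff[OF mu])
  have "norm (Complex (- t) (1 + t) - \<i>) \<le> t + t"
    using cmod_le[of "Complex (- t) (1 + t) - \<i>"] t by simp
  then show "dist (Complex (- t) (1 + t)) \<i> < e"
    using t by (simp add: dist_norm)
qed

lemma approx_vertex:
  assumes "e > 0"
  shows "\<exists>z\<in>hecke_triangle \<mu>. dist z (hecke_vertex \<mu>) < e"
proof
  define c s where "c = cos (pi / real \<mu>)" and "s = sin (pi / real \<mu>)"
  have c: "0 < c" "c < 1"
    using hecke_width_pos[OF mu] hecke_width_less_2 by (auto simp: c_def hecke_width_def)
  have s: "0 < s" "s \<le> 1"
    using hecke_vertex_in_upper_half_plane[OF mu]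
    by (auto simp: s_def upper_half_plane_iff hecke_vertex_Re_Im[OF mu])
  define t where "t = min (e / 4) (c / 2)"
  have t: "t > 0" "2 * t < e" "t < c"
    using assms c by (auto simp: t_def)
  \<comment> \<open>With this offset t (s + \<i>) from the vertex the squared norm changes to first
    order by 2 t s (1 - c) > 0, so the point lies outside the unit disc. The offset t (1 + \<i>)
    would give 2 t (s - c), which is negative for \<mu> > 4.\<close>
  let ?z = "Complex (- c + s * t) (s + t)"
  have st: "s * t \<le> t" using s t by (simp add: mult_left_le_one_le)
  have "(norm ?z)\<^sup>2 = (c\<^sup>2 + s\<^sup>2) + 2 * (s * t) * (1 - c) + ((s * t)\<^sup>2 + t\<^sup>2)"
    by (simp add: cmod_power2) (simp add: power2_eq_square algebra_simps)
  also have "c\<^sup>2 + s\<^sup>2 = 1" by (simp add: c_def s_def)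
  finally have "(norm ?z)\<^sup>2 > 1\<^sup>2"
    using c s t by (simp add: add_pos_nonneg)
  then have "norm ?z > 1"
    by (rule power_less_imp_less_base) simp
  then show "?z \<in> hecke_triangle \<mu>"
    using c s t le_less_trans[OF st t(3)]
    unfolding hecke_triangle_def mem_Collect_eq hecke_vertex_Re_Im[OF mu] c_def[symmetric]
    by simp
  have "norm (?z - hecke_vertex \<mu>) \<le> s * t + t"
    using cmod_le[of "?z - hecke_vertex \<mu>"] s t
    by (simp add: hecke_vertex_Re_Im[OF mu] c_def[symmetric] s_def[symmetric])
  then show "dist ?z (hecke_vertex \<mu>) < e"
    using t st unfolding dist_norm by linarith
qed

definition closed_triangle :: "complex set" where
  "closed_triangle = {z. Im z > 0 \<and> - hecke_width \<mu> / 2 \<le> Re z \<and> Re z \<le> 0 \<and> norm z \<ge> 1}"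

text \<open>In the open triangle J takes values in the upper half plane. On an open side, the
  reflection in that side makes \<open>J_neq_of_reflection\<close> applicable against both corners,
  where J is 1 and 0. Hence the corners are the only bad points of \<open>disc_quotient\<close> on
  the closed triangle.\<close>

lemma J_not_0_1:
  assumes p: "p \<in> closed_triangle" "p \<noteq> \<i>" "p \<noteq> hecke_vertex \<mu>"
  shows "J p \<noteq> 0" "J p \<noteq> 1"
proof -
  have p': "Im p > 0" "- hecke_width \<mu> / 2 \<le> Re p" "Re p \<le> 0" "norm p \<ge> 1"
    using p(1) by (auto simp: closed_triangle_def)
  note wpos = hecke_width_pos[OF mu]
  have "J p \<noteq> 0 \<and> J p \<noteq> 1"
  proof (cases "p \<in> hecke_triangle \<mu>")
    case True
    then have "Im (J p) > 0" using J_image by (auto simp: upper_half_plane_iff)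
    then show ?thesis by auto
  next
    case False
    have not_i: "\<not> (Re p = 0 \<and> norm p = 1)"
      using p(2) p' by (auto simp: complex_eq_iff cmod_def power2_eq_1_iff)
    have not_v: "\<not> (Re p = - hecke_width \<mu> / 2 \<and> norm p = 1)"
    proof
      assume *: "Re p = - hecke_width \<mu> / 2 \<and> norm p = 1"
      then have "Re p = Re (hecke_vertex \<mu>)"
        by (simp add: hecke_vertex_Re_Im[OF mu] hecke_width_def)
      then have "(Im p)\<^sup>2 = (Im (hecke_vertex \<mu>))\<^sup>2"
        using * cmod_power2[of p] cmod_power2[of "hecke_vertex \<mu>"] norm_hecke_vertex[of \<mu>] by auto
      then have "Im p = Im (hecke_vertex \<mu>)"
        using p' hecke_vertex_in_upper_half_plane[OF mu]
        by (intro power2_eq_imp_eq[of "Im p" "Im (hecke_vertex \<mu>)"]) (auto simp: upper_half_plane_iff)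
      then have "p = hecke_vertex \<mu>"
        using * by (simp add: complex_eq_iff hecke_vertex_Re_Im[OF mu] hecke_width_def)
      then show False using p(3) by simp
    qed
    have "\<exists>N \<sigma>. p \<in> N \<and> open N \<and> N \<subseteq> upper_half_plane \<and> (\<forall>z\<in>N. J (\<sigma> z) = cnj (J z)) \<and>
        (\<forall>z\<in>N. z \<in> hecke_triangle \<mu> \<or> \<sigma> z \<in> hecke_triangle \<mu> \<or> \<sigma> z = z)"
    proof -
      \<comment> \<open>In each case N is the triangle together with its mirror image in the side
        through p and that open side itself; its other bounds are the remaining sides and their
        mirror images.\<close>
      consider "Re p = 0" | "Re p = - hecke_width \<mu> / 2" |
          "norm p = 1" "- hecke_width \<mu> / 2 < Re p" "Re p < 0"
        using False p' unfolding hecke_triangle_iff[OF mu] by linarith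
      then show ?thesis
      proof cases
        case 1
        define N where "N = {z. Im z > 0} \<inter> {z. Re z > - hecke_width \<mu> / 2} \<inter>
          {z. Re z < hecke_width \<mu> / 2} \<inter> - cball 0 1"
        have "open N" unfolding N_def
          by (intro open_Int open_halfspace_Im_gt open_halfspace_Re_gt open_halfspace_Re_lt) auto
        moreover have "p \<in> N" using 1 not_i p' wpos by (auto simp: N_def)
        moreover have "z \<in> hecke_triangle \<mu> \<or> - cnj z \<in> hecke_triangle \<mu> \<or> - cnj z = z"
          if "z \<in> N" for z
          using that by (cases "Re z" "0 :: real" rule: linorder_cases)
            (auto simp: N_def hecke_triangle_iff[OF mu] complex_eq_iff)
        ultimately show ?thesis using J_minus_cnj
          by (intro exI[of _ N] exI[of _ "\<lambda>z. - cnj z"]) (auto simp: N_def upper_half_plane_iff)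
      next
        case 2
        define N where "N = {z. Im z > 0} \<inter> {z. Re z > - hecke_width \<mu>} \<inter>
          {z. Re z < 0} \<inter> - cball 0 1 \<inter> - cball (- of_real (hecke_width \<mu>)) 1"
        have "open N" unfolding N_def
          by (intro open_Int open_halfspace_Im_gt open_halfspace_Re_gt open_halfspace_Re_lt) auto
        moreover have "p \<in> N"
        proof -
          have "- of_real (hecke_width \<mu>) - p = cnj p"
            using 2 by (simp add: complex_eq_iff)
          then have "norm (- of_real (hecke_width \<mu>) - p) = norm p"
            by (simp only: complex_mod_cnj)
          then show ?thesis using 2 not_v p' wpos by (auto simp: N_def dist_norm)
        qed
        moreover have "z \<in> hecke_triangle \<mu> \<or> - of_real (hecke_width \<mu>) - cnj z \<in> hecke_triangle \<mu> \<or>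
            - of_real (hecke_width \<mu>) - cnj z = z" if "z \<in> N" for z
        proof -
          have "norm (- of_real (hecke_width \<mu>) - cnj z) = norm (- of_real (hecke_width \<mu>) - z)"
            using complex_mod_cnj[of "- of_real (hecke_width \<mu>) - z"] by simp
          then show ?thesis
            using that by (cases "Re z" "- hecke_width \<mu> / 2" rule: linorder_cases)
              (auto simp: N_def hecke_triangle_iff[OF mu] complex_eq_iff dist_norm)
        qed
        ultimately show ?thesis using J_reflect_width
          by (intro exI[of _ N] exI[of _ "\<lambda>z. - of_real (hecke_width \<mu>) - cnj z"])
            (auto simp: N_def upper_half_plane_iff)
      next
        case 3
        define N where "N = (upper_half_plane \<inter> (\<lambda>z. Re (1 / cnj z)) -` {- hecke_width \<mu> / 2<..}) \<inter>
          {z. Re z > - hecke_width \<mu> / 2} \<inter> {z. Re z < 0}"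
        have "continuous_on upper_half_plane (\<lambda>z. Re (1 / cnj z))"
          by (intro continuous_intros) (auto simp: upper_half_plane_iff)
        then have "open N" unfolding N_def
          by (intro open_Int open_halfspace_Re_gt open_halfspace_Re_lt continuous_open_preimage
              open_upper_half_plane open_greaterThan)
        \<comment> \<open>Inversion multiplies z by a positive real number, so it preserves the
          signs of real and imaginary part.\<close>
        moreover have inv: "1 / cnj z = of_real (1 / (norm z)\<^sup>2) * z" if "z \<noteq> 0" for z
          using that complex_norm_square[of z] by (simp add: field_simps)
        moreover have "p \<in> N"
        proof -
          have "p \<noteq> 0" using 3 by auto
          then have "1 / cnj p = p" using inv[of p] 3 by simp
          then show ?thesis using 3 p' by (simp add: N_def upper_half_plane_iff)
        qed
        moreover have "z \<in> hecke_triangle \<mu> \<or> 1 / cnj z \<in> hecke_triangle \<mu> \<or> 1 / cnj z = z"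
          if "z \<in> N" for z
        proof -
          have z: "z \<noteq> 0" using that by (auto simp: N_def upper_half_plane_iff)
          consider "norm z > 1" | "norm z = 1" | "norm z < 1" by linarith
          then show ?thesis
          proof cases
            case 3
            have "Im (1 / cnj z) > 0" "Re (1 / cnj z) < 0"
              using that z unfolding inv[OF z] by (auto simp: N_def upper_half_plane_iff divide_neg_pos)
            moreover have "norm (1 / cnj z) > 1" using 3 z by (simp add: norm_divide)
            ultimately show ?thesis using that by (auto simp: N_def hecke_triangle_iff[OF mu])
          qed (use that inv[OF z] in \<open>auto simp: N_def hecke_triangle_iff[OF mu] upper_half_plane_iff\<close>)
        qed
        ultimately show ?thesis using J_inverse_cnj
          by (intro exI[of _ N] exI[of _ "\<lambda>z. 1 / cnj z"]) (auto simp: N_def)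
      qed
    qed
    then obtain N \<sigma> where "p \<in> N" "open N" "N \<subseteq> upper_half_plane"
        "\<And>z. z \<in> N \<Longrightarrow> J (\<sigma> z) = cnj (J z)"
        "\<And>z. z \<in> N \<Longrightarrow> z \<in> hecke_triangle \<mu> \<or> \<sigma> z \<in> hecke_triangle \<mu> \<or> \<sigma> z = z"
      by metis
    note * = J_neq_of_reflection[OF this(1-3) _ _ _ this(4,5)]
    show ?thesis
      using *[OF _ p(2) approx_i] *[OF _ p(3) approx_vertex] hecke_vertex_in_upper_half_plane[OF mu]
      by simp
  qed
  then show "J p \<noteq> 0" "J p \<noteq> 1" by auto
qed

text \<open>Away from the zeros of J (J - 1) and up to a constant factor, this is the discriminant
  for odd \<mu> and its square for even \<mu>. Both parities are thus treated at once, with weight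
  4\<mu>.\<close>

definition disc_quotient :: "complex \<Rightarrow> complex" where
  "disc_quotient z = deriv J z ^ (2 * \<mu>) / (J z ^ (2 * \<mu> - 2) * (J z - 1) ^ \<mu>)"

text \<open>S fixes \<i> with derivative -1, so J - 1 has even order n \<ge> 2 there; this is the
  condition \<mu> n \<le> 2\<mu> (n - 1).\<close>

lemma disc_quotient_limit_i: "\<exists>l. (disc_quotient \<longlongrightarrow> l) (at \<i>)"
proof -
  have nc: "\<not> (\<lambda>z. J z - 1) constant_on upper_half_plane"
    using J_not_constant by (auto simp: constant_on_def algebra_simps)
  have dU: "((\<lambda>z. - 1 / z) has_field_derivative - 1) (at \<i>)"
    by (auto intro!: derivative_eq_intros simp: power2_eq_square)
  have hol: "(\<lambda>z. J z - 1) holomorphic_on upper_half_plane"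
    using holomorphic_J by (intro holomorphic_intros)
  obtain g r n where g: "0 < n" "0 < r" "ball \<i> r \<subseteq> upper_half_plane"
      "g holomorphic_on ball \<i> r"
      "\<And>w. w \<in> ball \<i> r \<Longrightarrow> J w - 1 = (w - \<i>) ^ n * g w"
      "\<And>w. w \<in> ball \<i> r \<Longrightarrow> g w \<noteq> 0" "(- 1 :: complex) ^ n = 1"
    by (rule invariant_zero_order[OF hol open_upper_half_plane connected_upper_half_plane
        ii_in_upper_half_plane _ nc _ dU]) (auto simp: J_S simp del: divide_minus_left)
  from g(1,7) have "even n"
    by (cases "even n") auto
  with g(1) have "n \<ge> 2" by (auto elim!: evenE)
  then have "2 * (n - 1) \<ge> n" by linarith
  then have "\<mu> * n \<le> 2 * \<mu> * (n - 1)"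
    using mult_le_mono2[of n "2 * (n - 1)" \<mu>] by (simp add: mult.assoc mult.left_commute)
  then obtain l where l: "((\<lambda>z. deriv (\<lambda>w. J w - 1) z ^ (2 * \<mu>) / (J z - 1) ^ \<mu>) \<longlongrightarrow> l) (at \<i>)"
    using tendsto_deriv_power_quotient[OF g(2,4,5,6,1)] by metis
  have "((\<lambda>z. deriv (\<lambda>w. J w - 1) z ^ (2 * \<mu>) / (J z - 1) ^ \<mu> * (1 / J z ^ (2 * \<mu> - 2)))
      \<longlongrightarrow> l * (1 / 1 ^ (2 * \<mu> - 2))) (at \<i>)"
    using isCont_J[of \<i>] by (intro tendsto_intros l) (auto simp: isCont_def)
  moreover have "\<forall>\<^sub>F z in at \<i>. deriv (\<lambda>w. J w - 1) z ^ (2 * \<mu>) / (J z - 1) ^ \<mu> *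
      (1 / J z ^ (2 * \<mu> - 2)) = disc_quotient z"
  proof -
    have "\<forall>\<^sub>F z in at \<i>. z \<in> upper_half_plane"
      using open_upper_half_plane by (intro eventually_at_in_open') auto
    then show ?thesis
    proof eventually_elim
      case (elim z)
      have "((\<lambda>w. J w - 1) has_field_derivative deriv J z) (at z)"
        using holomorphic_derivI[OF holomorphic_J open_upper_half_plane elim]
        by (auto intro!: derivative_eq_intros)
      then have "deriv (\<lambda>w. J w - 1) z = deriv J z" by (rule DERIV_imp_deriv)
      then show ?case by (simp add: disc_quotient_def mult.commute)
    qed
  qed
  ultimately show ?thesis by (blast intro: Lim_transform_eventually)
qed

text \<open>The elliptic element at the vertex v has derivative 1 / v^2, a primitive \<mu>-th root
  of unity, so \<mu> divides the order n of J. The condition (2\<mu> - 2) n \<le> 2\<mu> (n - 1)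
  says precisely n \<ge> \<mu>.\<close>

lemma disc_quotient_limit_vertex: "\<exists>l. (disc_quotient \<longlongrightarrow> l) (at (hecke_vertex \<mu>))"
proof -
  let ?v = "hecke_vertex \<mu>" and ?U = "\<lambda>z. - 1 / z - of_real (hecke_width \<mu>)"
  note v = hecke_vertex_in_upper_half_plane[OF mu]
  have v0: "?v \<noteq> 0" by (simp add: hecke_vertex_def)
  have U: "?U ?v = ?v"
    using minus_inverse_hecke_vertex[OF mu] by (simp add: algebra_simps)
  have dU: "(?U has_field_derivative 1 / ?v\<^sup>2) (at ?v)"
    using v0 by (auto intro!: derivative_eq_intros simp: power2_eq_square)
  have inv: "J (?U z) = J z" if "z \<in> upper_half_plane" for z
    using J_T[of "?U z"] J_S[OF that] Im_minus_inverse_pos[of z] that by (simp add: upper_half_plane_iff)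
  obtain g r n where g: "0 < n" "0 < r" "ball ?v r \<subseteq> upper_half_plane"
      "g holomorphic_on ball ?v r"
      "\<And>w. w \<in> ball ?v r \<Longrightarrow> J w = (w - ?v) ^ n * g w"
      "\<And>w. w \<in> ball ?v r \<Longrightarrow> g w \<noteq> 0" "(1 / ?v\<^sup>2) ^ n = 1"
    using invariant_zero_order[OF holomorphic_J open_upper_half_plane connected_upper_half_plane v J_vertex
        J_not_constant, of ?U, OF U dU inv] by metis
  have "n \<ge> \<mu>"
  proof (rule ccontr)
    assume "\<not> n \<ge> \<mu>"
    have "?v ^ (2 * n) = 1"
      using g(7) v0 by (simp add: power_divide power_mult)
    moreover have "?v ^ (2 * n) = exp (of_nat (2 * n) * (\<i> * of_real (pi - pi / real \<mu>)))"
      unfolding hecke_vertex_eq_cis[OF mu] by (rule exp_of_nat_mult[symmetric])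
    ultimately have "exp (of_nat (2 * n) * (\<i> * of_real (pi - pi / real \<mu>))) = 1" by simp
    then obtain k :: int where "Im (of_nat (2 * n) * (\<i> * of_real (pi - pi / real \<mu>))) = of_int (2 * k) * pi"
      unfolding exp_eq_1 by blast
    then have "real (2 * n) * (pi - pi / real \<mu>) = of_int (2 * k) * pi" by simp
    then have "pi * (real n * (real \<mu> - 1)) = pi * (of_int k * real \<mu>)"
      using mu by (simp add: field_simps)
    then have "real n * (real \<mu> - 1) = of_int k * real \<mu>" by simp
    then have "real_of_int (int n * (int \<mu> - 1)) = real_of_int (k * int \<mu>)" by simp
    then have "int n * (int \<mu> - 1) = k * int \<mu>" by (simp only: of_int_eq_iff)
    then have "int n = (int n - k) * int \<mu>" by (simp add: algebra_simps)
    then have "int \<mu> dvd int n" by (metis dvd_triv_right)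
    then have "\<mu> dvd n" by simp
    then show False using g(1) \<open>\<not> n \<ge> \<mu>\<close> dvd_imp_le by blast
  qed
  have "(2 * \<mu> - 2) * n \<le> 2 * \<mu> * (n - 1)"
    using \<open>n \<ge> \<mu>\<close> g(1) mu by (cases n) (auto simp: algebra_simps diff_mult_distrib)
  then obtain l where l: "((\<lambda>z. deriv J z ^ (2 * \<mu>) / J z ^ (2 * \<mu> - 2)) \<longlongrightarrow> l) (at ?v)"
    using tendsto_deriv_power_quotient[OF g(2,4,5,6,1)] by metis
  have "((\<lambda>z. deriv J z ^ (2 * \<mu>) / J z ^ (2 * \<mu> - 2) * (1 / (J z - 1) ^ \<mu>))
      \<longlongrightarrow> l * (1 / (0 - 1) ^ \<mu>)) (at ?v)"
    using isCont_J[OF v] by (intro tendsto_intros l) (auto simp: isCont_def)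
  then show ?thesis
    by (intro exI) (simp add: disc_quotient_def[abs_def])
qed

section \<open>Behaviour of the quotient under S, T and reflection\<close>

lemma deriv_J_S:
  assumes z: "z \<in> upper_half_plane"
  shows "deriv J (- 1 / z) = z\<^sup>2 * deriv J z"
proof -
  have z': "- 1 / z \<in> upper_half_plane" "z \<noteq> 0"
    using z Im_minus_inverse_pos[of z] by (auto simp: upper_half_plane_iff)
  have "((\<lambda>z. - 1 / z) has_field_derivative 1 / z\<^sup>2) (at z)"
    using z' by (auto intro!: derivative_eq_intros simp: power2_eq_square)
  from DERIV_chain2[OF holomorphic_derivI[OF holomorphic_J open_upper_half_plane z'(1)] this]
  have "((\<lambda>z. J (- 1 / z)) has_field_derivative deriv J (- 1 / z) * (1 / z\<^sup>2)) (at z)" .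
  then have "(J has_field_derivative deriv J (- 1 / z) * (1 / z\<^sup>2)) (at z)"
    using z J_S by (rule has_field_derivative_transform_within_open[OF _ open_upper_half_plane])
  from DERIV_imp_deriv[OF this] show ?thesis using z' by (simp add: field_simps)
qed

lemma deriv_J_T:
  assumes z: "z \<in> upper_half_plane"
  shows "deriv J (z + of_real (hecke_width \<mu>)) = deriv J z"
proof -
  have z': "z + of_real (hecke_width \<mu>) \<in> upper_half_plane"
    using z by (auto simp: upper_half_plane_iff)
  have "((\<lambda>z. z + of_real (hecke_width \<mu>)) has_field_derivative 1) (at z)"
    by (auto intro!: derivative_eq_intros)
  from DERIV_chain2[OF holomorphic_derivI[OF holomorphic_J open_upper_half_plane z'] this]
  have "((\<lambda>z. J (z + of_real (hecke_width \<mu>))) has_field_derivative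
      deriv J (z + of_real (hecke_width \<mu>)) * 1) (at z)" .
  then have "(J has_field_derivative deriv J (z + of_real (hecke_width \<mu>)) * 1) (at z)"
    using z J_T by (rule has_field_derivative_transform_within_open[OF _ open_upper_half_plane])
  from DERIV_imp_deriv[OF this] show ?thesis by simp
qed

lemma deriv_J_minus_cnj:
  assumes z: "z \<in> upper_half_plane"
  shows "deriv J (- cnj z) = - cnj (deriv J z)"
proof -
  have z': "- cnj z \<in> upper_half_plane" using z by (simp add: upper_half_plane_iff)
  have "(uminus has_field_derivative - 1) (at (cnj z))"
    by (auto intro!: derivative_eq_intros)
  from DERIV_chain2[OF holomorphic_derivI[OF holomorphic_J open_upper_half_plane z'] this]
  have "((\<lambda>w. J (- w)) has_field_derivative - deriv J (- cnj z)) (at (cnj z))" by simp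
  from has_field_derivative_cnj_cnj[OF this]
  have "((\<lambda>w. cnj (J (- cnj w))) has_field_derivative cnj (- deriv J (- cnj z))) (at z)"
    by (simp add: o_def)
  then have "(J has_field_derivative cnj (- deriv J (- cnj z))) (at z)"
    by (rule has_field_derivative_transform_within_open[OF _ open_upper_half_plane z])
      (simp add: J_minus_cnj)
  from DERIV_imp_deriv[OF this] show ?thesis by simp
qed

lemma disc_quotient_S:
  assumes "z \<in> upper_half_plane"
  shows "disc_quotient (- 1 / z) = z ^ (4 * \<mu>) * disc_quotient z"
  unfolding disc_quotient_def deriv_J_S[OF assms] J_S[OF assms]
  by (simp add: power_mult_distrib power_mult[symmetric])

lemma disc_quotient_T:
  "z \<in> upper_half_plane \<Longrightarrow> disc_quotient (z + of_real (hecke_width \<mu>)) = disc_quotient z"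
  by (simp add: disc_quotient_def deriv_J_T J_T)

text \<open>The minus sign in \<open>deriv_J_minus_cnj\<close> disappears in the even power
  2\<mu>.\<close>

lemma disc_quotient_minus_cnj:
  "z \<in> upper_half_plane \<Longrightarrow> disc_quotient (- cnj z) = cnj (disc_quotient z)"
  by (simp add: disc_quotient_def deriv_J_minus_cnj J_minus_cnj)

lemma vertex_in_closed_triangle:
  "hecke_vertex \<mu> \<in> closed_triangle" "Re (hecke_vertex \<mu>) = - hecke_width \<mu> / 2"
  "\<i> \<in> closed_triangle"
  using hecke_vertex_in_upper_half_plane[OF mu] hecke_width_pos[OF mu]
  by (auto simp: closed_triangle_def upper_half_plane_iff norm_hecke_vertex
      hecke_vertex_Re_Im[OF mu] hecke_width_def)

text \<open>
  \<open>X\<close> is real on the sides of the triangle, since each of the three reflections maps \<open>X\<close> to its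
  conjugate, and its limits at the vertices are then real as well. The maximum modulus principle for
  \<open>exp (\<plusminus> \<i> X)\<close> makes \<open>X\<close> real in the interior too.
\<close>

lemma invariant_function_constant:
  fixes X E :: "complex \<Rightarrow> complex"
  defines "X \<equiv> (\<lambda>z. disc_quotient z * E z)"
  assumes E: "E holomorphic_on upper_half_plane"
    and E_S: "\<And>z. z \<in> upper_half_plane \<Longrightarrow> E (- 1 / z) = E z / z ^ (4 * \<mu>)"
    and E_T: "\<And>z. z \<in> upper_half_plane \<Longrightarrow> E (z + of_real (hecke_width \<mu>)) = E z"
    and E_cnj: "\<And>z. z \<in> upper_half_plane \<Longrightarrow> E (- cnj z) = cnj (E z)"
    and lim: "(X \<longlongrightarrow> l) (filtercomap Im at_top)"
    and U: "open U" "connected U" "U \<subseteq> hecke_triangle \<mu>"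
  shows "X constant_on U"
proof -
  note wpos = hecke_width_pos[OF mu]
  let ?v = "hecke_vertex \<mu>"
  have contE: "isCont E z" if "z \<in> upper_half_plane" for z
    using holomorphic_on_imp_continuous_on[OF E] that open_upper_half_plane
    by (simp add: continuous_on_eq_continuous_at)
  have inv: "X (- 1 / z) = X z" "X (z + of_real (hecke_width \<mu>)) = X z" "X (- cnj z) = cnj (X z)"
    if "z \<in> upper_half_plane" for z
    using that disc_quotient_S[OF that] disc_quotient_T[OF that] disc_quotient_minus_cnj[OF that]
      E_S[OF that] E_T[OF that] E_cnj[OF that]
    by (auto simp: X_def upper_half_plane_iff)
  have side: "Im (X z) = 0" if z: "z \<in> closed_triangle" "z \<notin> hecke_triangle \<mu>" for z
  proof -
    have zH: "z \<in> upper_half_plane" using z by (simp add: closed_triangle_def upper_half_plane_iff)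
    \<comment> \<open>On the three sides -cnj z is the image of z under the identity, T and S
      respectively.\<close>
    consider "Re z = 0" | "Re z = - hecke_width \<mu> / 2" | "norm z = 1"
      using z unfolding hecke_triangle_iff[OF mu] closed_triangle_def by fastforce
    then have "X z = X (- cnj z)"
    proof cases
      case 1
      then have "- cnj z = z" by (simp add: complex_eq_iff)
      then show ?thesis by simp
    next
      case 2
      then have "- cnj z = z + of_real (hecke_width \<mu>)" by (simp add: complex_eq_iff)
      then show ?thesis using inv(2)[OF zH] by simp
    next
      case 3
      then have "z * cnj z = 1" by (simp flip: complex_norm_square)
      moreover have "z \<noteq> 0" using 3 by auto
      ultimately have "- cnj z = - 1 / z" by (simp add: field_simps)
      then show ?thesis using inv(1)[OF zH] by simp
    qed
    then have "X z = cnj (X z)" using inv(3)[OF zH] by simp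
    then show ?thesis by (simp add: complex_eq_iff)
  qed
  \<comment> \<open>All three limits are taken along vertical rays starting at \<i> or at the
    vertex, because these rays are the vertical sides. F is the filter at \<i>, at the vertex or at
    \<i>\<infinity>.\<close>
  have limit_real: "Im m = 0"
    if m: "(X \<longlongrightarrow> m) F" and s: "filterlim (\<lambda>n. p + \<i> * of_real (t n)) F sequentially"
      and t: "\<And>n. t n > 0"
      and p: "p \<in> closed_triangle" "Re p = 0 \<or> Re p = - hecke_width \<mu> / 2"
    for m F p and t :: "nat \<Rightarrow> real"
  proof -
    have "Im (X (p + \<i> * of_real (t n))) = 0" for n
    proof (rule side)
      have "(norm (p + \<i> * of_real (t n)))\<^sup>2 \<ge> (norm p)\<^sup>2"
        using p t[of n] by (auto simp: cmod_power2 closed_triangle_def intro!: power_mono)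
      then have "norm (p + \<i> * of_real (t n)) \<ge> norm p"
        by (rule power2_le_imp_le) simp
      then show "p + \<i> * of_real (t n) \<in> closed_triangle"
        using p t[of n] by (auto simp: closed_triangle_def)
      show "p + \<i> * of_real (t n) \<notin> hecke_triangle \<mu>"
        using p by (auto simp: hecke_triangle_iff[OF mu])
    qed
    moreover have "(\<lambda>n. Im (X (p + \<i> * of_real (t n)))) \<longlonglongrightarrow> Im m"
      by (intro tendsto_intros filterlim_compose[OF m s])
    ultimately show ?thesis
      by (simp add: LIMSEQ_const_iff)
  qed
  have vertical: "filterlim (\<lambda>n. p + \<i> * of_real (1 / Suc n)) (at p) sequentially" for p
  proof (rule filterlim_atI)
    have "(\<lambda>n. p + \<i> * of_real (1 / Suc n)) \<longlonglongrightarrow> p + \<i> * of_real 0"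
      by (intro tendsto_intros LIMSEQ_Suc[OF lim_1_over_n])
    then show "(\<lambda>n. p + \<i> * of_real (1 / Suc n)) \<longlonglongrightarrow> p" by simp
  qed (simp add: complex_eq_iff)
  obtain li where "(disc_quotient \<longlongrightarrow> li) (at \<i>)" using disc_quotient_limit_i by blast
  then have Xi: "(X \<longlongrightarrow> li * E \<i>) (at \<i>)"
    unfolding X_def using contE[of \<i>] by (intro tendsto_intros) (auto simp: isCont_def)
  obtain lv where "(disc_quotient \<longlongrightarrow> lv) (at ?v)" using disc_quotient_limit_vertex by blast
  then have Xv: "(X \<longlongrightarrow> lv * E ?v) (at ?v)"
    unfolding X_def using contE[OF hecke_vertex_in_upper_half_plane[OF mu]]
    by (intro tendsto_intros) (auto simp: isCont_def)
  have "Im (li * E \<i>) = 0"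
    using limit_real[OF Xi vertical] vertex_in_closed_triangle by auto
  moreover have "Im (lv * E ?v) = 0"
    using limit_real[OF Xv vertical] vertex_in_closed_triangle by auto
  moreover have "Im l = 0"
  proof (rule limit_real[OF lim])
    show "filterlim (\<lambda>n. \<i> + \<i> * of_real (real (Suc n))) (filtercomap Im at_top) sequentially"
      unfolding filterlim_filtercomap_iff
    proof -
      show "filterlim (Im \<circ> (\<lambda>n. \<i> + \<i> * complex_of_real (real (Suc n)))) at_top sequentially"
        unfolding o_def
        using filterlim_real_sequentially
        by (rule filterlim_at_top_mono) auto
    qed
  qed (use vertex_in_closed_triangle in auto)
  ultimately have real: "Im (li * E \<i>) = 0" "Im (lv * E ?v) = 0" "Im l = 0" by auto
  \<comment> \<open>At the two corners the formula for X divides by 0; \<Psi> puts the limits there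
    and is thereby continuous on the closed triangle.\<close>
  define \<Psi> where "\<Psi> z = (if z = \<i> then li * E \<i> else if z = ?v then lv * E ?v else X z)" for z
  have ev: "\<forall>\<^sub>F z in at p. X z = \<Psi> z" for p
  proof -
    have "\<forall>\<^sub>F z in at p. z \<noteq> \<i>" "\<forall>\<^sub>F z in at p. z \<noteq> ?v"
      by (rule eventually_neq_at_within)+
    then show ?thesis by eventually_elim (auto simp: \<Psi>_def)
  qed
  have cont\<Psi>: "isCont \<Psi> z" if z: "z \<in> closed_triangle" for z
  proof -
    have zH: "z \<in> upper_half_plane" using z by (simp add: closed_triangle_def upper_half_plane_iff)
    have "(X \<longlongrightarrow> \<Psi> z) (at z)"
    proof (cases "z = \<i> \<or> z = ?v")
      case True
      then show ?thesis using Xi Xv by (auto simp: \<Psi>_def)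
    next
      case False
      then have "J z \<noteq> 0" "J z \<noteq> 1" using J_not_0_1[OF z] by auto
      moreover have "isCont (deriv J) z"
        using holomorphic_on_imp_continuous_on[OF holomorphic_deriv[OF holomorphic_J open_upper_half_plane]]
          zH open_upper_half_plane by (simp add: continuous_on_eq_continuous_at)
      ultimately have "isCont X z"
        unfolding X_def disc_quotient_def using isCont_J[OF zH] contE[OF zH]
        by (intro continuous_intros) auto
      then show ?thesis using False by (simp add: isCont_def \<Psi>_def)
    qed
    then show ?thesis
      unfolding isCont_def using ev[of z] by (rule Lim_transform_eventually)
  qed
  have side': "Im (\<Psi> z) = 0" if "z \<in> closed_triangle" "z \<notin> hecke_triangle \<mu>" for z
    using side[OF that] real by (auto simp: \<Psi>_def)
  have notin: "\<i> \<notin> hecke_triangle \<mu>" "?v \<notin> hecke_triangle \<mu>"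
    by (auto simp: hecke_triangle_def)
  have holX: "X holomorphic_on hecke_triangle \<mu>"
  proof -
    have "J z \<noteq> 0 \<and> J z \<noteq> 1" if "z \<in> hecke_triangle \<mu>" for z
    proof -
      have "Im (J z) > 0" using that J_image by (auto simp: upper_half_plane_iff)
      then show ?thesis by auto
    qed
    then show ?thesis
      unfolding X_def disc_quotient_def
      using holomorphic_on_subset[OF holomorphic_J hecke_triangle_subset]
        holomorphic_on_subset[OF E hecke_triangle_subset] open_hecke_triangle
      by (auto intro!: holomorphic_intros)
  qed
  have small: "\<bar>Im (X z)\<bar> \<le> \<epsilon>" if \<epsilon>: "\<epsilon> > 0" and z: "z \<in> hecke_triangle \<mu>" for \<epsilon> z
  proof -
    have "\<forall>\<^sub>F z in filtercomap Im at_top. dist (X z) l < \<epsilon>"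
      using lim \<epsilon> by (rule tendstoD)
    then obtain Y0 where Y0: "\<And>z. Im z \<ge> Y0 \<Longrightarrow> dist (X z) l < \<epsilon>"
      by (auto simp: eventually_filtercomap_at_top_linorder)
    have top: "\<bar>Im (X z)\<bar> \<le> \<epsilon>" if "Im z \<ge> Y0" for z
      using Y0[OF that] abs_Im_le_cmod[of "X z - l"] real(3) by (simp add: dist_norm)
    define Y where "Y = max Y0 2"
    \<comment> \<open>The maximum modulus principle needs a bounded set, so the triangle is cut off
      at height Y. On the new edge X is within \<epsilon> of the real number l.\<close>
    define S where "S = hecke_triangle \<mu> \<inter> {z. Im z < Y}"
    have "open S" unfolding S_def by (intro open_Int open_hecke_triangle open_halfspace_Im_lt)
    then have int: "interior S = S" by (rule interior_open)
    have "closure S \<subseteq> {z. Im z \<ge> 0} \<inter> {z. Re z \<ge> - hecke_width \<mu> / 2} \<inter> {z. Re z \<le> 0} \<inter>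
        {z. Im z \<le> Y} \<inter> {z. norm z \<ge> 1}"
      by (rule closure_minimal) (auto simp: S_def hecke_triangle_iff[OF mu]
          intro!: closed_Int closed_halfspace_Im_ge closed_halfspace_Re_ge closed_halfspace_Re_le
            closed_halfspace_Im_le closed_Collect_le continuous_intros)
    \<comment> \<open>The closure stays off the real axis, since the width is less than 2 and so the
      real part is less than 1 in absolute value.\<close>
    moreover have "Im z \<noteq> 0" if "Re z \<ge> - hecke_width \<mu> / 2" "Re z \<le> 0" "norm z \<ge> 1" for z
      using that hecke_width_less_2 cmod_le[of z] by auto
    ultimately have clS: "z \<in> closed_triangle" "Im z \<le> Y" if "z \<in> closure S" for z
      using that by (force simp: closed_triangle_def)+
    have "bounded S"
    proof (rule bounded_subset)
      show "S \<subseteq> cball 0 (1 + Y)"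
      proof
        fix z assume "z \<in> S"
        then have "\<bar>Re z\<bar> \<le> 1" "\<bar>Im z\<bar> \<le> Y"
          using hecke_width_less_2 by (auto simp: S_def hecke_triangle_iff[OF mu])
        then show "z \<in> cball 0 (1 + Y)" using cmod_le[of z] by simp
      qed
    qed simp
    have frontier: "\<bar>Im (\<Psi> z)\<bar> \<le> \<epsilon>" if "z \<in> frontier S" for z
    proof -
      have z: "z \<in> closure S" "z \<notin> S" using that int by (auto simp: frontier_def)
      show ?thesis
      proof (cases "z \<in> hecke_triangle \<mu>")
        case True
        then have "Im z = Y" using z clS(2)[OF z(1)] by (auto simp: S_def)
        then show ?thesis using top[of z] True notin by (auto simp: \<Psi>_def Y_def)
      next
        case False
        then show ?thesis using side'[OF clS(1)[OF z(1)]] \<epsilon> by simp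
      qed
    qed
    have "\<bar>Im (\<Psi> z)\<bar> \<le> \<epsilon>" if zS: "z \<in> S" for z
    proof -
      \<comment> \<open>The norm is exp (- c Im \<Psi>), so the two signs of c bound Im \<Psi> from
        below and from above.\<close>
      have *: "norm (exp (c * \<i> * \<Psi> z)) \<le> exp \<epsilon>" if "c = 1 \<or> c = - 1" for c
      proof (rule maximum_modulus_frontier[OF _ _ \<open>bounded S\<close> _ zS])
        have "\<Psi> holomorphic_on S"
        proof (rule holomorphic_transform)
          show "X holomorphic_on S" using holX by (rule holomorphic_on_subset) (auto simp: S_def)
        qed (use notin in \<open>auto simp: S_def \<Psi>_def\<close>)
        then show "(\<lambda>z. exp (c * \<i> * \<Psi> z)) holomorphic_on interior S"
          unfolding int by (intro holomorphic_intros)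
        have "continuous_on (closure S) \<Psi>"
          using clS(1) cont\<Psi> by (intro continuous_at_imp_continuous_on) auto
        then show "continuous_on (closure S) (\<lambda>z. exp (c * \<i> * \<Psi> z))"
          by (intro continuous_intros)
        show "norm (exp (c * \<i> * \<Psi> z)) \<le> exp \<epsilon>" if "z \<in> frontier S" for z
          using frontier[OF that] \<open>c = 1 \<or> c = - 1\<close> by auto
      qed
      show ?thesis using *[of 1] *[of "-1"] by simp
    qed
    moreover have "z \<in> S \<or> Im z \<ge> Y0" using z by (auto simp: S_def Y_def)
    moreover have "\<Psi> z = X z" using z notin by (auto simp: \<Psi>_def)
    ultimately show ?thesis using top[of z] by metis
  qed
  have X0: "Im (X z) = 0" if "z \<in> hecke_triangle \<mu>" for z
    using field_le_epsilon[of "\<bar>Im (X z)\<bar>" 0] small[OF _ that] by simp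
  show ?thesis
  proof (rule ccontr)
    assume nc: "\<not> X constant_on U"
    then obtain u where u: "u \<in> U" by (auto simp: constant_on_def)
    have "open (X ` U)"
      using open_mapping_thm[OF holomorphic_on_subset[OF holX U(3)] U(1,2) U(1) subset_refl nc] .
    then obtain e where e: "e > 0" "ball (X u) e \<subseteq> X ` U"
      using u by (meson imageI open_contains_ball)
    have "X u + \<i> * of_real (e / 2) \<in> ball (X u) e"
      using e by (simp add: dist_norm norm_mult)
    then obtain u' where "u' \<in> U" "X u' = X u + \<i> * of_real (e / 2)" using e by (metis imageE subsetD)
    moreover have "Im (X u) = 0" "Im (X u') = 0"
      using X0 u U(3) \<open>u' \<in> U\<close> by blast+
    ultimately show False using e by simp
  qed
qed

end

section \<open>Behaviour at infinity\<close>

text \<open>F is f composed with a logarithm, and periodicity makes it independent of the branch.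
  The principal branch shows holomorphy off the negative axis, and Ln (-x) + \<i>\<pi> off the
  positive axis; together they cover the punctured disc.\<close>

lemma periodic_factors_through_hecke_q:
  assumes \<mu>: "\<mu> \<ge> 3" and f: "f holomorphic_on {z. Im z > Y}"
    and per: "\<And>z. Im z > Y \<Longrightarrow> f (z + of_real (hecke_width \<mu>)) = f z"
  obtains F where "F holomorphic_on ball 0 (exp (- 2 * pi * Y / hecke_width \<mu>)) - {0}"
    "\<And>z. Im z > Y \<Longrightarrow> F (hecke_q \<mu> z) = f z"
proof -
  note wpos = hecke_width_pos[OF \<mu>]
  define a where "a = of_real (hecke_width \<mu>) / (2 * of_real pi * \<i>)"
  define R where "R = exp (- 2 * pi * Y / hecke_width \<mu>)"
  have per_nat: "f (z + of_nat n * of_real (hecke_width \<mu>)) = f z" if "Im z > Y" for z n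
  proof (induction n)
    case (Suc n)
    then show ?case
      using per[of "z + of_nat n * of_real (hecke_width \<mu>)"] that by (simp add: algebra_simps)
  qed simp
  have per_int: "f (z + of_int n * of_real (hecke_width \<mu>)) = f z" if "Im z > Y" for z n
  proof (cases "n \<ge> 0")
    case True
    then show ?thesis using per_nat[OF that, of "nat n"] by simp
  next
    case False
    then show ?thesis
      using per_nat[of "z + of_int n * of_real (hecke_width \<mu>)" "nat (- n)"] that by simp
  qed
  have eq: "f z = f z'" if "hecke_q \<mu> z = hecke_q \<mu> z'" "Im z' > Y" for z z'
  proof -
    from that(1) obtain n :: int where
      n: "2 * of_real pi * \<i> * z / of_real (hecke_width \<mu>) =
        2 * of_real pi * \<i> * z' / of_real (hecke_width \<mu>) + of_real (of_int (2 * n) * pi) * \<i>"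
      unfolding hecke_q_def exp_eq by blast
    have "z = a * (2 * of_real pi * \<i> * z / of_real (hecke_width \<mu>))"
      using wpos by (simp add: a_def)
    also have "\<dots> = z' + of_int n * of_real (hecke_width \<mu>)"
      unfolding n using wpos by (simp add: a_def field_simps)
    finally show ?thesis using per_int[OF that(2)] by simp
  qed
  have Im_gt: "Im w > Y" if "hecke_q \<mu> w \<in> ball 0 R" for w
  proof -
    have "exp (- 2 * pi * Im w / hecke_width \<mu>) < exp (- 2 * pi * Y / hecke_width \<mu>)"
      using that by (simp add: R_def norm_hecke_q)
    then show ?thesis using wpos by (simp add: divide_less_cancel)
  qed
  define F where "F x = f (a * Ln x)" for x
  have F_eq: "F x = f w" if "hecke_q \<mu> w = x" "x \<in> ball 0 R" for x w
  proof -
    have "hecke_q \<mu> (a * Ln x) = x"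
      using hecke_q_surj(1)[OF \<mu>, of x] that(1) hecke_q_nonzero[of \<mu> w] unfolding a_def by blast
    then show ?thesis
      unfolding F_def using that by (intro eq Im_gt) auto
  qed
  have hol: "F holomorphic_on A"
    if g: "g holomorphic_on A" and gq: "\<And>x. x \<in> A \<Longrightarrow> hecke_q \<mu> (g x) = x"
      and A: "A \<subseteq> ball 0 R" for g A
  proof (rule holomorphic_transform)
    have "g ` A \<subseteq> {z. Im z > Y}" using gq A Im_gt by force
    then show "(\<lambda>x. f (g x)) holomorphic_on A"
      using holomorphic_on_compose_gen[OF g f] by (simp add: o_def)
    show "f (g x) = F x" if "x \<in> A" for x
      using F_eq[OF gq[OF that]] A that by auto
  qed
  have q1: "hecke_q \<mu> (a * Ln x) = x" if "x \<noteq> 0" for x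
    using hecke_q_surj(1)[OF \<mu> that] by (simp only: a_def)
  have q2: "hecke_q \<mu> (a * (Ln (- x) + \<i> * of_real pi)) = x" if "x \<noteq> 0" for x
  proof -
    have "2 * of_real pi * \<i> * (a * (Ln (- x) + \<i> * of_real pi)) / of_real (hecke_width \<mu>) =
        Ln (- x) + \<i> * of_real pi"
      using wpos by (simp add: a_def)
    then show ?thesis using that by (simp add: hecke_q_def exp_add)
  qed
  have "F holomorphic_on (ball 0 R - \<real>\<^sub>\<le>\<^sub>0)"
    by (rule hol[of "\<lambda>x. a * Ln x"]) (auto intro!: holomorphic_intros q1)
  moreover have "F holomorphic_on (ball 0 R - \<real>\<^sub>\<ge>\<^sub>0)"
    by (rule hol[of "\<lambda>x. a * (Ln (- x) + \<i> * of_real pi)"])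
      (auto intro!: holomorphic_intros q2 simp: complex_nonpos_Reals_iff complex_nonneg_Reals_iff)
  ultimately have "F holomorphic_on (ball 0 R - \<real>\<^sub>\<le>\<^sub>0) \<union> (ball 0 R - \<real>\<^sub>\<ge>\<^sub>0)"
    by (intro holomorphic_on_Un) (auto intro!: open_Diff)
  then have "F holomorphic_on ball 0 R - {0}"
    by (rule holomorphic_on_subset)
      (auto simp: complex_nonpos_Reals_iff complex_nonneg_Reals_iff complex_eq_iff)
  moreover have "F (hecke_q \<mu> z) = f z" if "Im z > Y" for z
  proof (rule F_eq[OF refl])
    show "hecke_q \<mu> z \<in> ball 0 R"
      using that wpos by (simp add: R_def norm_hecke_q divide_less_cancel)
  qed
  ultimately show ?thesis using that unfolding R_def by blast
qed

lemma hecke_q_tendsto_0: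
  assumes "\<mu> \<ge> 3"
  shows "(hecke_q \<mu> \<longlongrightarrow> 0) (filtercomap Im at_top)"
proof (rule tendsto_norm_zero_cancel)
  have "((\<lambda>y. exp (- 2 * pi * y / hecke_width \<mu>)) \<longlongrightarrow> 0) at_top"
    using hecke_width_pos[OF assms] by real_asymp
  from filterlim_compose[OF this filterlim_filtercomap]
  show "((\<lambda>z. norm (hecke_q \<mu> z)) \<longlongrightarrow> 0) (filtercomap Im at_top)"
    by (simp add: norm_hecke_q)
qed

context hecke_hauptmodul
begin

text \<open>Since J tends to infinity, 1/J descends to a punctured disc in q and extends by 0 across
  the puncture. It is not constant, so it has a zero of some positive order n there; n is left
  undetermined.\<close>

lemma inverse_J_q_expansion:
  obtains Y R n G where "Y > 0" "0 < R" "0 < n" "G holomorphic_on ball 0 R"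
    "\<And>x. x \<in> ball 0 R \<Longrightarrow> G x \<noteq> 0"
    "\<And>z. Im z > Y \<Longrightarrow> hecke_q \<mu> z \<in> ball 0 R"
    "\<And>z. Im z > Y \<Longrightarrow> J z \<noteq> 0 \<and> J z \<noteq> 1"
    "\<And>z. Im z > Y \<Longrightarrow> 1 / J z = hecke_q \<mu> z ^ n * G (hecke_q \<mu> z)"
proof -
  note wpos = hecke_width_pos[OF mu]
  have J_inf: "filterlim J at_infinity (filtercomap Im at_top)"
    using hauptmodul by (simp add: is_hecke_hauptmodul_def)
  then have "\<forall>\<^sub>F z in filtercomap Im at_top. 2 \<le> norm (J z)"
    by (subst (asm) filterlim_at_infinity[of 0]) auto
  then obtain Y1 where Y1: "\<And>z. Im z \<ge> Y1 \<Longrightarrow> 2 \<le> norm (J z)"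
    by (auto simp: eventually_filtercomap_at_top_linorder)
  define Y where "Y = max Y1 1"
  \<comment> \<open>The bound 2 keeps J away from 0 and from 1 at the same time.\<close>
  have J2: "2 \<le> norm (J z)" if "Im z > Y" for z using Y1[of z] that by (simp add: Y_def)
  then have Jne: "J z \<noteq> 0 \<and> J z \<noteq> 1" if "Im z > Y" for z using that by force
  define R where "R = exp (- 2 * pi * Y / hecke_width \<mu>)"
  have sub: "{z. Im z > Y} \<subseteq> upper_half_plane" by (auto simp: Y_def upper_half_plane_iff)
  have "(\<lambda>z. 1 / J z) holomorphic_on {z. Im z > Y}"
    using holomorphic_on_subset[OF holomorphic_J sub] Jne by (auto intro!: holomorphic_intros)
  moreover have "1 / J (z + of_real (hecke_width \<mu>)) = 1 / J z" if "Im z > Y" for z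
    using J_T[of z] that sub by auto
  ultimately obtain F where F: "F holomorphic_on ball 0 R - {0}"
      and Fq: "\<And>z. Im z > Y \<Longrightarrow> F (hecke_q \<mu> z) = 1 / J z"
    using periodic_factors_through_hecke_q[OF mu, of "\<lambda>z. 1 / J z" Y] unfolding R_def by blast
  have lift: "\<exists>z. hecke_q \<mu> z = x \<and> Im z > B"
    if x: "x \<noteq> 0" "norm x < exp (- 2 * pi * B / hecke_width \<mu>)" for x B
  proof -
    define w where "w = of_real (hecke_width \<mu>) / (2 * of_real pi * \<i>) * Ln x"
    have w: "hecke_q \<mu> w = x" using hecke_q_surj(1)[OF mu x(1)] by (simp only: w_def)
    then have "exp (- 2 * pi * Im w / hecke_width \<mu>) < exp (- 2 * pi * B / hecke_width \<mu>)"
      using x(2) norm_hecke_q[of \<mu> w] by simp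
    then have "Im w > B" using wpos by (simp add: divide_less_cancel)
    with w show ?thesis by blast
  qed
  have "(F \<longlongrightarrow> 0) (at 0)"
  proof (rule tendstoI)
    fix e :: real assume "e > 0"
    have "((\<lambda>z. inverse (J z)) \<longlongrightarrow> 0) (filtercomap Im at_top)"
      using J_inf by (rule tendsto_inverse_0[THEN filterlim_compose])
    from tendstoD[OF this \<open>e > 0\<close>] obtain B where B: "\<And>z. Im z \<ge> B \<Longrightarrow> norm (inverse (J z)) < e"
      by (auto simp: eventually_filtercomap_at_top_linorder)
    have "dist (F x) 0 < e"
      if x: "x \<noteq> 0" "dist x 0 < exp (- 2 * pi * max B Y / hecke_width \<mu>)" for x
    proof -
      obtain z where z: "hecke_q \<mu> z = x" "Im z > max B Y"
        using lift[of x "max B Y"] x unfolding dist_norm diff_0_right by blast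
      then show ?thesis using B[of z] Fq[of z] by (simp add: inverse_eq_divide)
    qed
    then show "\<forall>\<^sub>F x in at 0. dist (F x) 0 < e"
      unfolding eventually_at by (intro exI[of _ "exp (- 2 * pi * max B Y / hecke_width \<mu>)"]) auto
  qed
  define F0 where "F0 x = (if x = 0 then 0 else F x)" for x
  have hol: "F0 holomorphic_on ball 0 R"
    unfolding F0_def by (rule removable_singularity[OF F open_ball \<open>(F \<longlongrightarrow> 0) (at 0)\<close>])
  have nc: "\<not> F0 constant_on ball 0 R"
  proof
    assume "F0 constant_on ball 0 R"
    then obtain c where c: "\<And>x. x \<in> ball 0 R \<Longrightarrow> F0 x = c"
      by (auto simp: constant_on_def)
    have R: "R > 0" by (simp add: R_def)
    then have "c = 0" using c[of 0] by (simp add: F0_def)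
    moreover obtain z where z: "hecke_q \<mu> z = of_real (R / 2)" "Im z > Y"
      using lift[of "of_real (R / 2)" Y] R by (auto simp: R_def)
    moreover have "F (of_real (R / 2)) = c"
      using c[of "of_real (R / 2)"] R by (simp add: F0_def)
    ultimately have "1 / J z = 0" using Fq[of z] by metis
    then show False using Jne[OF z(2)] by simp
  qed
  have zero: "0 \<in> ball (0 :: complex) R" "F0 0 = 0" by (simp_all add: R_def F0_def)
  obtain G r n where G: "0 < n" "0 < r" "ball (0 :: complex) r \<subseteq> ball 0 R" "G holomorphic_on ball 0 r"
      "\<And>x. x \<in> ball 0 r \<Longrightarrow> F0 x = (x - 0) ^ n * G x"
      "\<And>x. x \<in> ball 0 r \<Longrightarrow> G x \<noteq> 0"
    using holomorphic_factor_zero_nonconstant[OF hol open_ball connected_ball zero nc] by metis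
  have "\<forall>\<^sub>F z in filtercomap Im at_top. dist (hecke_q \<mu> z) 0 < r"
    using tendstoD[OF hecke_q_tendsto_0[OF mu] G(2)] .
  then obtain B where B: "\<And>z. Im z \<ge> B \<Longrightarrow> norm (hecke_q \<mu> z) < r"
    by (auto simp: eventually_filtercomap_at_top_linorder)
  show ?thesis
  proof (rule that[of "max B Y" r n G])
    show "1 / J z = hecke_q \<mu> z ^ n * G (hecke_q \<mu> z)" if "Im z > max B Y" for z
      using that G(5)[of "hecke_q \<mu> z"] B[of z] Fq[of z] by (simp add: F0_def)
    show "max B Y > 0" by (simp add: Y_def max_def)
  qed (use G B Jne in auto)
qed

text \<open>With x = q and k = 1/J = x^n G(x) one has J' = - p / k for p = t (n + x G'/G), and the
  quotient becomes p^(2\<mu>) k^(\<mu>-2) / (1 - k)^\<mu>. Dividing by x^(\<mu>-2) leaves powers of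
  k/x = x^(n-1) G(x), which is continuous at 0 because n \<ge> 1. The resulting function of x is
  H.\<close>

lemma disc_quotient_q_limit:
  "\<exists>l. ((\<lambda>z. disc_quotient z / hecke_q \<mu> z ^ (\<mu> - 2)) \<longlongrightarrow> l) (filtercomap Im at_top)"
proof -
  obtain Y R n G where YR: "Y > 0" "0 < R" "0 < n" "G holomorphic_on ball 0 R"
    and Gnz: "\<And>x. x \<in> ball 0 R \<Longrightarrow> G x \<noteq> 0"
    and q: "\<And>z. Im z > Y \<Longrightarrow> hecke_q \<mu> z \<in> ball 0 R"
    and Jne: "\<And>z. Im z > Y \<Longrightarrow> J z \<noteq> 0 \<and> J z \<noteq> 1"
    and K: "\<And>z. Im z > Y \<Longrightarrow> 1 / J z = hecke_q \<mu> z ^ n * G (hecke_q \<mu> z)"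
    using inverse_J_q_expansion by metis
  define t where "t = 2 * of_real pi * \<i> / complex_of_real (hecke_width \<mu>)"
  define H where "H x = (t * (of_nat n + x * deriv G x / G x)) ^ (2 * \<mu>) *
    (x ^ (n - 1) * G x) ^ (\<mu> - 2) / (1 - x ^ n * G x) ^ \<mu>" for x
  have "isCont G 0" "isCont (deriv G) 0"
    using YR holomorphic_on_imp_continuous_on[OF YR(4)]
      holomorphic_on_imp_continuous_on[OF holomorphic_deriv[OF YR(4) open_ball]]
    by (auto simp: continuous_on_eq_continuous_at)
  then have "isCont H 0"
    unfolding H_def using YR Gnz[of 0] by (intro continuous_intros) (auto simp: power_0_left)
  then have "((\<lambda>z. H (hecke_q \<mu> z)) \<longlongrightarrow> H 0) (filtercomap Im at_top)"
    using hecke_q_tendsto_0[OF mu] isCont_tendsto_compose by blast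
  moreover have "H (hecke_q \<mu> z) = disc_quotient z / hecke_q \<mu> z ^ (\<mu> - 2)" if z: "Im z > Y" for z
  proof -
    define x where "x = hecke_q \<mu> z"
    have x: "x \<in> ball 0 R" "x \<noteq> 0" "G x \<noteq> 0" using q[OF z] Gnz by (auto simp: x_def)
    have xn: "x ^ n = x * x ^ (n - 1)" using YR(3) by (cases n) auto
    have "((\<lambda>z. hecke_q \<mu> z ^ n * G (hecke_q \<mu> z)) has_field_derivative
        of_nat n * x ^ (n - 1) * (t * x) * G x + x ^ n * (deriv G x * (t * x))) (at z)"
      unfolding x_def t_def
      using DERIV_chain2[OF holomorphic_derivI[OF YR(4) open_ball q[OF z]] has_field_derivative_hecke_q]
      by (auto intro!: derivative_eq_intros has_field_derivative_hecke_q simp: mult_ac)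
    from DERIV_divide[OF DERIV_const[of 1] this]
    have "((\<lambda>z. 1 / (hecke_q \<mu> z ^ n * G (hecke_q \<mu> z))) has_field_derivative
        - (of_nat n * x ^ (n - 1) * (t * x) * G x + x ^ n * (deriv G x * (t * x))) / (x ^ n * G x)\<^sup>2) (at z)"
      using x by (simp add: x_def power2_eq_square)
    then have "(J has_field_derivative
        - (of_nat n * x ^ (n - 1) * (t * x) * G x + x ^ n * (deriv G x * (t * x))) / (x ^ n * G x)\<^sup>2) (at z)"
    proof (rule has_field_derivative_transform_within_open[where S = "{z. Im z > Y}"])
      show "1 / (hecke_q \<mu> w ^ n * G (hecke_q \<mu> w)) = J w" if "w \<in> {z. Im z > Y}" for w
        using that by (simp flip: K)
    qed (use z in \<open>auto intro: open_halfspace_Im_gt\<close>)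
    then have "deriv J z =
        - (of_nat n * x ^ (n - 1) * (t * x) * G x + x ^ n * (deriv G x * (t * x))) / (x ^ n * G x)\<^sup>2"
      by (rule DERIV_imp_deriv)
    also have "\<dots> = - (t * (of_nat n + x * deriv G x / G x)) / (x ^ n * G x)"
      using x unfolding xn by (simp add: field_simps power2_eq_square)
    finally have dJ: "deriv J z = - (t * (of_nat n + x * deriv G x / G x)) / (x ^ n * G x)" .
    define k where "k = x ^ n * G x"
    define p where "p = t * (of_nat n + x * deriv G x / G x)"
    have k: "k \<noteq> 0" "J z = 1 / k"
      using K[OF z] Jne[OF z] x by (auto simp: k_def x_def field_simps)
    have k1: "1 - k \<noteq> 0" using k Jne[OF z] by auto
    have "disc_quotient z = (- p / k) ^ (2 * \<mu>) / ((1 / k) ^ (2 * \<mu> - 2) * (1 / k - 1) ^ \<mu>)"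
      by (simp only: disc_quotient_def dJ k(2) k_def[symmetric] p_def[symmetric])
    also have "1 / k - 1 = (1 - k) / k" using k by (simp add: field_simps)
    also have "(- p / k) ^ (2 * \<mu>) = p ^ (2 * \<mu>) / k ^ (2 * \<mu>)"
      by (simp add: power_divide power_mult)
    also have "p ^ (2 * \<mu>) / k ^ (2 * \<mu>) / ((1 / k) ^ (2 * \<mu> - 2) * ((1 - k) / k) ^ \<mu>) =
        p ^ (2 * \<mu>) * k ^ (\<mu> - 2) / (1 - k) ^ \<mu>"
    proof -
      have *: "P / a / (1 / b * (c / d)) = P * f / c" if "b * d = a * f" "a \<noteq> 0" "b \<noteq> 0" "d \<noteq> 0"
        for P a b c d f :: complex
      proof -
        have "P / a / (1 / b * (c / d)) = P * (b * d) / (a * c)" by simp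
        then show ?thesis using that by simp
      qed
      have "2 * \<mu> - 2 + \<mu> = 2 * \<mu> + (\<mu> - 2)" using mu by simp
      then have "k ^ (2 * \<mu> - 2) * k ^ \<mu> = k ^ (2 * \<mu>) * k ^ (\<mu> - 2)"
        by (simp only: power_add[symmetric])
      from *[OF this] show ?thesis using k(1) by (simp only: power_divide power_one) simp
    qed
    also have "\<dots> / x ^ (\<mu> - 2) = p ^ (2 * \<mu>) * (k / x) ^ (\<mu> - 2) / (1 - k) ^ \<mu>"
      by (simp add: power_divide)
    also have "k / x = x ^ (n - 1) * G x"
      unfolding k_def xn using x by simp
    finally show ?thesis by (simp only: H_def x_def[symmetric] p_def k_def)
  qed
  then have "\<forall>\<^sub>F z in filtercomap Im at_top. H (hecke_q \<mu> z) = disc_quotient z / hecke_q \<mu> z ^ (\<mu> - 2)"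
    unfolding eventually_filtercomap_at_top_dense by blast
  ultimately show ?thesis by (blast intro: Lim_transform_eventually)
qed

section \<open>The discriminant and the Wronskian\<close>

text \<open>
  A primitive \<open>L\<close> need not satisfy \<open>L (- cnj z) = cnj (L z)\<close>, so \<open>invariant_function_constant\<close> is applied
  to the symmetric and the antisymmetric part of \<open>exp (- (\<mu> - 2) L)\<close>.
\<close>

lemma deriv_J_power_eq:
  assumes E2: "is_hecke_E2 \<mu> E2"
  obtains L C where "C \<noteq> 0"
    and "\<And>z. z \<in> upper_half_plane \<Longrightarrow>
      (L has_field_derivative 2 * of_real pi * \<i> / of_real (hecke_width \<mu>) * E2 z) (at z)"
    and "\<And>z. z \<in> upper_half_plane \<Longrightarrow> deriv J z ^ (2 * \<mu>) =
      C * (J z ^ (2 * \<mu> - 2) * (J z - 1) ^ \<mu>) * exp ((of_nat \<mu> - 2) * L z)"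
proof -
  let ?F = "filtercomap Im at_top :: complex filter"
  obtain M L where M: "M holomorphic_on ball 0 1" "M 0 = 0"
    and L_eq: "\<And>z. L z = 2 * of_real pi * \<i> * z / of_real (hecke_width \<mu>) + M (hecke_q \<mu> z)"
    and L: "\<And>z. z \<in> upper_half_plane \<Longrightarrow>
      (L has_field_derivative 2 * of_real pi * \<i> / of_real (hecke_width \<mu>) * E2 z) (at z)"
    and L_S: "\<And>z. z \<in> upper_half_plane \<Longrightarrow>
      L (- 1 / z) = L z + 4 * of_nat \<mu> / (of_nat \<mu> - 2) * (Ln z - \<i> * of_real pi / 2)"
    using hecke_E2_primitive[OF mu E2] by metis
  \<comment> \<open>The factor \<mu> - 2 clears the denominator in the transformation law of L, so e
    has weight -4\<mu>. At infinity e behaves like q to the power -(\<mu> - 2), which is cancelled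
    by the order of the quotient there.\<close>
  define e where "e z = exp (- ((of_nat \<mu> - 2) * L z))" for z
  have holL: "L holomorphic_on upper_half_plane"
    using L holomorphic_on_open[OF open_upper_half_plane] by blast
  have hole: "e holomorphic_on upper_half_plane"
    unfolding e_def using holL by (intro holomorphic_intros)
  have mu2: "(of_nat \<mu> - 2 :: complex) \<noteq> 0"
    using mu of_nat_eq_iff[of \<mu> 2, where ?'a = complex] by simp
  have e_S: "e (- 1 / z) = e z / z ^ (4 * \<mu>)" if z: "z \<in> upper_half_plane" for z
  proof -
    have "z \<noteq> 0" using z by (auto simp: upper_half_plane_iff)
    have "(of_nat \<mu> - 2) * L (- 1 / z) =
        (of_nat \<mu> - 2) * L z + 4 * of_nat \<mu> * (Ln z - \<i> * of_real pi / 2)"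
      unfolding L_S[OF z] using mu2 by (simp add: distrib_left)
    also have "\<dots> = (of_nat \<mu> - 2) * L z + (of_nat (4 * \<mu>) * Ln z - of_nat \<mu> * (2 * of_real pi * \<i>))"
      by (simp add: algebra_simps)
    finally have "e (- 1 / z) = e z / (exp (of_nat (4 * \<mu>) * Ln z) / exp (of_nat \<mu> * (2 * of_real pi * \<i>)))"
      unfolding e_def by (simp only: exp_minus exp_add exp_diff) (simp add: field_simps)
    also have "exp (of_nat (4 * \<mu>) * Ln z) = z ^ (4 * \<mu>)"
      by (simp only: exp_of_nat_mult exp_Ln[OF \<open>z \<noteq> 0\<close>])
    also have "exp (of_nat \<mu> * (2 * of_real pi * \<i>)) = 1"
      by (simp only: exp_of_nat_mult) simp
    finally show ?thesis by simp
  qed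
  have e_T: "e (z + of_real (hecke_width \<mu>)) = e z" for z
  proof -
    have "L (z + of_real (hecke_width \<mu>)) = L z + 2 * of_real pi * \<i>"
      using hecke_width_pos[OF mu] unfolding L_eq hecke_q_add_width[OF mu] by (simp add: field_simps)
    then have "(of_nat \<mu> - 2) * L (z + of_real (hecke_width \<mu>)) =
        (of_nat \<mu> - 2) * L z + of_nat (\<mu> - 2) * (2 * of_real pi * \<i>)"
      using mu by (simp add: algebra_simps of_nat_diff)
    moreover have "exp (of_nat (\<mu> - 2) * (2 * of_real pi * \<i>)) = 1"
      by (simp only: exp_of_nat_mult) simp
    ultimately show ?thesis by (simp only: e_def exp_minus exp_add mult_1_right)
  qed
  have q_e: "hecke_q \<mu> z ^ (\<mu> - 2) * e z = exp (- ((of_nat \<mu> - 2) * M (hecke_q \<mu> z)))" for z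
  proof -
    have "hecke_q \<mu> z ^ (\<mu> - 2) = exp (of_nat (\<mu> - 2) *
        (2 * of_real pi * \<i> * z / of_real (hecke_width \<mu>)))"
      unfolding hecke_q_def by (rule exp_of_nat_mult[symmetric])
    then show ?thesis
      using mu by (simp add: e_def L_eq exp_add[symmetric] of_nat_diff algebra_simps)
  qed
  have "isCont M 0"
    using holomorphic_on_imp_continuous_on[OF M(1)] by (simp add: continuous_on_eq_continuous_at)
  then have "((\<lambda>z. M (hecke_q \<mu> z)) \<longlongrightarrow> M 0) ?F"
    using hecke_q_tendsto_0[OF mu] isCont_tendsto_compose by blast
  then have "((\<lambda>z. exp (- ((of_nat \<mu> - 2) * M (hecke_q \<mu> z)))) \<longlongrightarrow> exp (- ((of_nat \<mu> - 2) * M 0))) ?F"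
    by (intro tendsto_intros)
  then have lim_e: "((\<lambda>z. hecke_q \<mu> z ^ (\<mu> - 2) * e z) \<longlongrightarrow> 1) ?F"
    by (simp add: q_e M(2))
  define e' where "e' z = cnj (e (- cnj z))" for z
  have cnjH: "- cnj z \<in> upper_half_plane" if "z \<in> upper_half_plane" for z
    using that by (simp add: upper_half_plane_iff)
  have hole': "e' holomorphic_on upper_half_plane"
  proof -
    have img: "uminus ` (cnj ` upper_half_plane) \<subseteq> upper_half_plane"
      by (auto simp: upper_half_plane_iff)
    have "(e \<circ> uminus) holomorphic_on cnj ` upper_half_plane"
      by (rule holomorphic_on_compose_gen[OF _ hole img]) (intro holomorphic_intros)
    from holomorphic_on_compose_cnj_cnj[OF this open_upper_half_plane] show ?thesis
      by (simp add: e'_def[abs_def] o_def)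
  qed
  have e'_S: "e' (- 1 / z) = e' z / z ^ (4 * \<mu>)" if z: "z \<in> upper_half_plane" for z
  proof -
    have "- cnj (- 1 / z) = - 1 / (- cnj z)" by simp
    then show ?thesis
      using e_S[OF cnjH[OF z]] by (simp add: e'_def power_mult)
  qed
  have e'_T: "e' (z + of_real (hecke_width \<mu>)) = e' z" for z
    using e_T[of "- cnj z - of_real (hecke_width \<mu>)"] by (simp add: e'_def)
  have lim_e': "((\<lambda>z. hecke_q \<mu> z ^ (\<mu> - 2) * e' z) \<longlongrightarrow> 1) ?F"
  proof -
    have "filterlim (\<lambda>z. - cnj z) ?F ?F"
      unfolding filterlim_filtercomap_iff by (simp add: o_def filterlim_filtercomap)
    from tendsto_cnj[OF filterlim_compose[OF lim_e this]]
    have "((\<lambda>z. cnj (hecke_q \<mu> (- cnj z)) ^ (\<mu> - 2) * e' z) \<longlongrightarrow> 1) ?F"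
      by (simp add: e'_def)
    moreover have "cnj (hecke_q \<mu> (- cnj z)) = hecke_q \<mu> z" for z
      by (simp add: hecke_q_def exp_cnj)
    ultimately show ?thesis by simp
  qed
  obtain z0 where "z0 \<in> hecke_triangle \<mu>" using approx_i[of 1] by auto
  \<comment> \<open>A ball inside the triangle is enough: it is connected, and the identity found on
    it is continued analytically afterwards.\<close>
  then obtain \<rho> where \<rho>: "\<rho> > 0" "ball z0 \<rho> \<subseteq> hecke_triangle \<mu>"
    using open_hecke_triangle open_contains_ball by blast
  define U where "U = ball z0 \<rho>"
  have U: "open U" "connected U" "U \<subseteq> hecke_triangle \<mu>" "z0 \<in> U" using \<rho> by (auto simp: U_def)
  obtain l where l: "((\<lambda>z. disc_quotient z / hecke_q \<mu> z ^ (\<mu> - 2)) \<longlongrightarrow> l) ?F"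
    using disc_quotient_q_limit by blast
  \<comment> \<open>Reflection exchanges e and e' up to conjugation, so a e + b e' is compatible
    with it when a and b are conjugate.\<close>
  have combine: "(\<lambda>z. disc_quotient z * (a * e z + b * e' z)) constant_on U"
    if ab: "cnj a = b" for a b
  proof (rule invariant_function_constant[OF _ _ _ _ _ U(1-3)])
    show "(\<lambda>z. a * e z + b * e' z) holomorphic_on upper_half_plane"
      using hole hole' by (intro holomorphic_intros)
    show "a * e (- 1 / z) + b * e' (- 1 / z) = (a * e z + b * e' z) / z ^ (4 * \<mu>)"
      if "z \<in> upper_half_plane" for z
      unfolding e_S[OF that] e'_S[OF that] by (simp add: add_divide_distrib)
    show "a * e (- cnj z) + b * e' (- cnj z) = cnj (a * e z + b * e' z)" for z
      using ab by (auto simp: e'_def add.commute)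
    have "((\<lambda>z. disc_quotient z / hecke_q \<mu> z ^ (\<mu> - 2) *
        (a * (hecke_q \<mu> z ^ (\<mu> - 2) * e z) + b * (hecke_q \<mu> z ^ (\<mu> - 2) * e' z)))
        \<longlongrightarrow> l * (a * 1 + b * 1)) ?F"
      by (intro tendsto_intros l lim_e lim_e')
    moreover have "disc_quotient z / hecke_q \<mu> z ^ (\<mu> - 2) *
        (a * (hecke_q \<mu> z ^ (\<mu> - 2) * e z) + b * (hecke_q \<mu> z ^ (\<mu> - 2) * e' z)) =
        disc_quotient z * (a * e z + b * e' z)" for z
      by (simp add: field_simps)
    ultimately show "((\<lambda>z. disc_quotient z * (a * e z + b * e' z)) \<longlongrightarrow> l * (a * 1 + b * 1)) ?F"
      by (simp only:)
  qed (simp add: e_T e'_T)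
  obtain c1 where c1: "\<And>z. z \<in> U \<Longrightarrow> disc_quotient z * (1 / 2 * e z + 1 / 2 * e' z) = c1"
    using combine[of "1 / 2" "1 / 2"] by (auto simp: constant_on_def)
  obtain c2 where c2: "\<And>z. z \<in> U \<Longrightarrow> disc_quotient z * (- (\<i> / 2) * e z + \<i> / 2 * e' z) = c2"
    using combine[of "- (\<i> / 2)" "\<i> / 2"] by (auto simp: constant_on_def)
  \<comment> \<open>In the same combination of the two symmetrized functions e' cancels and e
    remains.\<close>
  define C where "C = c1 + \<i> * c2"
  have "disc_quotient z * e z = C" if "z \<in> U" for z
    unfolding C_def c1[OF that, symmetric] c2[OF that, symmetric] by (simp add: algebra_simps)
  moreover have "e z * exp ((of_nat \<mu> - 2) * L z) = 1" for z
    by (simp add: e_def exp_minus)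
  ultimately have quot: "disc_quotient z = C * exp ((of_nat \<mu> - 2) * L z)" if "z \<in> U" for z
    using that by (metis mult.assoc mult.right_neutral)
  have JU: "J z \<noteq> 0" "J z \<noteq> 1" if "z \<in> U" for z
  proof -
    have "J z \<in> upper_half_plane" using that U(3) J_image by blast
    then show "J z \<noteq> 0" "J z \<noteq> 1" by (auto simp: upper_half_plane_iff)
  qed
  \<comment> \<open>With the denominators cleared both sides are holomorphic on the whole half
    plane, including the zeros of J (J - 1).\<close>
  have eq: "deriv J z ^ (2 * \<mu>) = C * (J z ^ (2 * \<mu> - 2) * (J z - 1) ^ \<mu>) * exp ((of_nat \<mu> - 2) * L z)"
    if "z \<in> upper_half_plane" for z
  proof (rule analytic_continuation_open[OF U(1) open_upper_half_plane _ connected_upper_half_plane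
        _ _ _ _ that])
    show "U \<noteq> {}" using U(4) by blast
    show "U \<subseteq> upper_half_plane" using U(3) hecke_triangle_subset by blast
    show "(\<lambda>z. deriv J z ^ (2 * \<mu>)) holomorphic_on upper_half_plane"
      using holomorphic_J open_upper_half_plane by (intro holomorphic_intros)
    show "(\<lambda>z. C * (J z ^ (2 * \<mu> - 2) * (J z - 1) ^ \<mu>) * exp ((of_nat \<mu> - 2) * L z))
        holomorphic_on upper_half_plane"
      using holomorphic_J holL by (intro holomorphic_intros)
    show "deriv J z ^ (2 * \<mu>) = C * (J z ^ (2 * \<mu> - 2) * (J z - 1) ^ \<mu>) * exp ((of_nat \<mu> - 2) * L z)"
      if "z \<in> U" for z
      using quot[OF that] JU[OF that] by (simp add: disc_quotient_def field_simps)
  qed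
  have "C \<noteq> 0"
  proof
    assume "C = 0"
    then have "(J has_field_derivative 0) (at z)" if "z \<in> upper_half_plane" for z
      using eq[OF that] mu holomorphic_derivI[OF holomorphic_J open_upper_half_plane that, of UNIV] by simp
    from has_field_derivative_zero_imp_const[OF this]
    obtain c where "\<And>z. z \<in> upper_half_plane \<Longrightarrow> J z = c" by blast
    then show False
      using J_not_constant by (auto simp: constant_on_def)
  qed
  with L eq show ?thesis using that by blast
qed

text \<open>Off the zeros of J (J - 1) the identity for J'^(2\<mu>) turns the defining formula into
  a constant times an exponential. That exponential is holomorphic everywhere, so it is also the
  value that \<open>remove_sings\<close> assigns at those zeros.\<close>

lemma hecke_discriminant_eq:
  assumes E2: "is_hecke_E2 \<mu> E2"
  obtains L where
    "\<And>z. z \<in> upper_half_plane \<Longrightarrow> (L has_field_derivative 2 * of_real pi * \<i> / of_real (hecke_width \<mu>) *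
      (of_nat (disc_weight \<mu>) * (of_nat \<mu> - 2) / (4 * of_nat \<mu>)) * E2 z) (at z)"
    "\<And>z. z \<in> upper_half_plane \<Longrightarrow> hecke_discriminant \<mu> J z = exp (L z)"
proof -
  obtain L C where C: "C \<noteq> 0"
    and L: "\<And>z. z \<in> upper_half_plane \<Longrightarrow>
      (L has_field_derivative 2 * of_real pi * \<i> / of_real (hecke_width \<mu>) * E2 z) (at z)"
    and eq: "\<And>z. z \<in> upper_half_plane \<Longrightarrow> deriv J z ^ (2 * \<mu>) =
      C * (J z ^ (2 * \<mu> - 2) * (J z - 1) ^ \<mu>) * exp ((of_nat \<mu> - 2) * L z)"
    using deriv_J_power_eq[OF E2] by metis
  define w where "w = complex_of_real (hecke_width \<mu>) / (2 * of_real pi * \<i>)"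
  have w: "w \<noteq> 0" using hecke_width_pos[OF mu] by (simp add: w_def)
  define Z where "Z = {z \<in> upper_half_plane. J z * (J z - 1) = 0}"
  define U where "U = upper_half_plane - Z"
  define d where "d z = (if even \<mu>
     then (hecke_theta \<mu> J z / (J z * (J z - 1))) ^ \<mu> * J z * (J z - 1) ^ (\<mu> div 2)
     else (hecke_theta \<mu> J z / (J z * (J z - 1))) ^ (2 * \<mu>) * J z ^ 2 * (J z - 1) ^ \<mu>)" for z
  \<comment> \<open>The weight is 2\<mu> for even and 4\<mu> for odd \<mu>; s is its ratio to the
    weight 4\<mu> of \<open>disc_quotient\<close>.\<close>
  define s where "s = (if even \<mu> then 1 / 2 else 1 :: complex)"
  have weight: "of_nat (disc_weight \<mu>) = s * (4 * of_nat \<mu>)"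
  proof (cases "even \<mu>")
    case True
    then have "lcm 2 \<mu> = \<mu>" by simp
    then show ?thesis using True by (simp add: s_def disc_weight_def)
  next
    case False
    then have "lcm 2 \<mu> = 2 * \<mu>" by (simp add: lcm_coprime)
    then show ?thesis using False by (simp add: s_def disc_weight_def)
  qed
  have holL: "L holomorphic_on upper_half_plane"
    using L holomorphic_on_open[OF open_upper_half_plane] by blast
  have JU: "z \<in> upper_half_plane" "J z \<noteq> 0" "J z \<noteq> 1" if "z \<in> U" for z
    using that by (auto simp: U_def Z_def)
  have holJJ: "(\<lambda>z. J z * (J z - 1)) holomorphic_on upper_half_plane"
    using holomorphic_J by (intro holomorphic_intros)
  obtain \<beta> where \<beta>: "\<beta> \<in> upper_half_plane" "J \<beta> * (J \<beta> - 1) \<noteq> 0"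
  proof -
    obtain z where z: "z \<in> hecke_triangle \<mu>" using approx_i[of 1] by auto
    then have "Im (J z) > 0" using J_image by (auto simp: upper_half_plane_iff)
    then have "J z * (J z - 1) \<noteq> 0" by auto
    then show ?thesis using z hecke_triangle_subset that by blast
  qed
  have discrete: "\<forall>\<^sub>F z in at p. z \<in> U" if p: "p \<in> upper_half_plane" for p
    using non_zero_neighbour_alt[OF holJJ open_upper_half_plane connected_upper_half_plane p \<beta>]
    by eventually_elim (auto simp: U_def Z_def)
  \<comment> \<open>Zeros of a nonzero holomorphic function form a sparse set, and removing it does
    not disconnect the half plane.\<close>
  have connU: "connected U"
    unfolding U_def
  proof (rule sparse_imp_connected)
    show "Z sparse_in upper_half_plane"
      unfolding sparse_in_eventually_iff[OF open_upper_half_plane]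
      by (intro ballI eventually_mono[OF discrete]) (auto simp: U_def)
  qed (auto intro: open_upper_half_plane connected_upper_half_plane)
  have theta: "hecke_theta \<mu> J z = w * deriv J z" for z
    by (simp add: hecke_theta_def w_def)
  have base: "(hecke_theta \<mu> J z / (J z * (J z - 1))) ^ (2 * \<mu>) * J z ^ 2 * (J z - 1) ^ \<mu> =
      C * w ^ (2 * \<mu>) * exp ((of_nat \<mu> - 2) * L z)" if z: "z \<in> U" for z
  proof -
    have *: "v * (C * (j * k) * x) * i * k / (j * i * (k * k)) = C * v * x"
      if "i \<noteq> 0" "j \<noteq> 0" "k \<noteq> 0" for v x i j k :: complex
      using that by simp
    have "2 * \<mu> = (2 * \<mu> - 2) + 2" using mu by simp
    then have J2: "J z ^ (2 * \<mu>) = J z ^ (2 * \<mu> - 2) * J z ^ 2"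
      by (metis power_add)
    have J1: "(J z - 1) ^ (2 * \<mu>) = (J z - 1) ^ \<mu> * (J z - 1) ^ \<mu>"
      by (simp only: mult_2 power_add)
    have "(hecke_theta \<mu> J z / (J z * (J z - 1))) ^ (2 * \<mu>) * J z ^ 2 * (J z - 1) ^ \<mu> =
        w ^ (2 * \<mu>) * deriv J z ^ (2 * \<mu>) * J z ^ 2 * (J z - 1) ^ \<mu> /
        (J z ^ (2 * \<mu>) * (J z - 1) ^ (2 * \<mu>))"
      by (simp add: theta power_mult_distrib power_divide)
    also have "\<dots> = C * w ^ (2 * \<mu>) * exp ((of_nat \<mu> - 2) * L z)"
      unfolding eq[OF JU(1)[OF z]] J2 J1 using JU(2,3)[OF z] by (intro *) auto
    finally show ?thesis .
  qed
  have cont_d: "continuous_on U d"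
  proof -
    have "continuous_on U J" "continuous_on U (deriv J)"
      using holomorphic_on_imp_continuous_on[OF holomorphic_J]
        holomorphic_on_imp_continuous_on[OF holomorphic_deriv[OF holomorphic_J open_upper_half_plane]]
      by (auto intro: continuous_on_subset simp: U_def)
    then show ?thesis
      unfolding d_def theta using JU by (cases "even \<mu>") (auto intro!: continuous_intros)
  qed
  \<comment> \<open>The left side of \<open>base\<close> is d for odd and d^2 for even \<mu>. In the
    even case h has constant square, hence finitely many values, and is constant because U is
    connected.\<close>
  obtain c where c: "c \<noteq> 0" "\<And>z. z \<in> U \<Longrightarrow> d z = c * exp (s * (of_nat \<mu> - 2) * L z)"
  proof (cases "even \<mu>")
    case False
    then show ?thesis using that[of "C * w ^ (2 * \<mu>)"] base C w by (simp add: d_def s_def)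
  next
    case True
    define h where "h z = d z * exp (- (s * (of_nat \<mu> - 2) * L z))" for z
    have sq: "h z ^ 2 = C * w ^ (2 * \<mu>)" if "z \<in> U" for z
    proof -
      have "d z ^ 2 = (hecke_theta \<mu> J z / (J z * (J z - 1))) ^ (2 * \<mu>) * J z ^ 2 * (J z - 1) ^ \<mu>"
        using True by (auto simp: d_def power_mult_distrib power_mult[symmetric] mult.commute elim!: evenE)
      then have "d z ^ 2 = C * w ^ (2 * \<mu>) * exp ((of_nat \<mu> - 2) * L z)" using base[OF that] by simp
      moreover have "exp (- (s * (of_nat \<mu> - 2) * L z)) ^ 2 = exp (- ((of_nat \<mu> - 2) * L z))"
        using True by (simp add: s_def exp_double[symmetric])
      ultimately show ?thesis by (simp add: h_def power_mult_distrib exp_minus)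
    qed
    have "h constant_on U"
    proof (rule continuous_finite_range_constant[OF connU])
      show "continuous_on U h"
        unfolding h_def using cont_d holomorphic_on_imp_continuous_on[OF holL]
        by (intro continuous_intros) (auto intro: continuous_on_subset simp: U_def)
      have "h ` U \<subseteq> {x. x ^ 2 = C * w ^ (2 * \<mu>)}" using sq by auto
      then show "finite (h ` U)"
        by (rule finite_subset) (rule finite_nth_roots, simp)
    qed
    then obtain c where c: "\<And>z. z \<in> U \<Longrightarrow> h z = c" by (auto simp: constant_on_def)
    have "U \<noteq> {}" using eventually_happens[OF discrete[OF ii_in_upper_half_plane]] by auto
    then have "c \<noteq> 0" using sq c C w by fastforce
    moreover have "d z = c * exp (s * (of_nat \<mu> - 2) * L z)" if "z \<in> U" for z
      unfolding c[OF that, symmetric] h_def by (simp add: mult.assoc flip: exp_add)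
    ultimately show ?thesis using that by blast
  qed
  define L' where "L' z = s * (of_nat \<mu> - 2) * L z + Ln c" for z
  have expL': "exp (L' z) = c * exp (s * (of_nat \<mu> - 2) * L z)" for z
    using c(1) by (simp add: L'_def exp_add)
  show ?thesis
  proof (rule that[of L'])
    fix z assume z: "z \<in> upper_half_plane"
    have "of_nat (disc_weight \<mu>) * (of_nat \<mu> - 2) / (4 * of_nat \<mu>) = s * (of_nat \<mu> - 2)"
      unfolding weight using mu by simp
    then show "(L' has_field_derivative 2 * of_real pi * \<i> / of_real (hecke_width \<mu>) *
      (of_nat (disc_weight \<mu>) * (of_nat \<mu> - 2) / (4 * of_nat \<mu>)) * E2 z) (at z)"
      unfolding L'_def using L[OF z] by (auto intro!: derivative_eq_intros)
    have "isCont L z" using L[OF z] by (rule DERIV_isCont)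
    then have "((\<lambda>z. exp (L' z)) \<longlongrightarrow> exp (L' z)) (at z)"
      unfolding L'_def by (intro tendsto_intros) (simp add: isCont_def)
    moreover have "\<forall>\<^sub>F x in at z. exp (L' x) = d x"
      using discrete[OF z] by eventually_elim (simp add: c(2) expL')
    ultimately have "(d \<longlongrightarrow> exp (L' z)) (at z)" by (rule Lim_transform_eventually)
    then show "hecke_discriminant \<mu> J z = exp (L' z)"
      unfolding hecke_discriminant_def d_def by (rule remove_sings_eqI)
  qed
qed

end

lemma eq_const_mult_of_log_deriv:
  assumes "\<And>z. z \<in> upper_half_plane \<Longrightarrow> (f has_field_derivative h z * f z) (at z)"
    and "\<And>z. z \<in> upper_half_plane \<Longrightarrow> (L has_field_derivative h z) (at z)"
  obtains c where "\<And>z. z \<in> upper_half_plane \<Longrightarrow> f z = c * exp (L z)"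
proof -
  have "((\<lambda>z. f z * exp (- L z)) has_field_derivative 0) (at z)" if "z \<in> upper_half_plane" for z
    using assms[OF that] by (auto intro!: derivative_eq_intros)
  from has_field_derivative_zero_imp_const[OF this] obtain c
    where c: "\<And>z. z \<in> upper_half_plane \<Longrightarrow> f z * exp (- L z) = c" by blast
  have "f z = c * exp (L z)" if "z \<in> upper_half_plane" for z
    unfolding c[OF that, symmetric] by (simp add: mult.assoc flip: exp_add)
  then show ?thesis using that by blast
qed

text \<open>A branch of the power is determined only up to a constant factor, so one branch is
  exhibited and the formula is proved for all of them. Two logarithms of the discriminant have the
  same derivative, hence every branch has the same logarithmic derivative as the Wronskian;
  nonvanishing of the Wronskian at \<i> gives c \<noteq> 0.\<close>

theorem theorem75:
  fixes \<mu> r :: nat and w :: int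
    and E2 J :: "complex \<Rightarrow> complex"
    and B Y :: "nat \<Rightarrow> complex \<Rightarrow> complex"
    and lam :: "nat \<Rightarrow> int"
  assumes "\<mu> \<ge> 3" and "even w"
    and "is_hecke_E2 \<mu> E2"
    and "is_hecke_hauptmodul \<mu> J"
    and "\<And>j. 2 \<le> j \<Longrightarrow> j \<le> r + 1 \<Longrightarrow> B (2 * j) \<in> automorphic_forms \<mu> (2 * int j)"
    and "fundamental_solution_vector \<mu> E2 w r B Y"
    and "has_vanishing_orders \<mu> E2 w r B {# complex_of_int (lam i). i \<in># mset_set {..r} #}"
    and "\<And>i j. i \<le> j \<Longrightarrow> j \<le> r \<Longrightarrow> lam j \<le> lam i"
    and "lam r \<ge> 0"
  shows "(\<exists>P. is_power_branch (hecke_discriminant \<mu> J)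
              (of_int w * of_nat (r + 1) / of_nat (disc_weight \<mu>)) P) \<and>
         (\<forall>P. is_power_branch (hecke_discriminant \<mu> J)
              (of_int w * of_nat (r + 1) / of_nat (disc_weight \<mu>)) P \<longrightarrow>
            (\<exists>c. c \<noteq> 0 \<and>
               (\<forall>z\<in>upper_half_plane. serre_wronskian \<mu> E2 w r Y z = c * P z)))"
proof -
  interpret hecke_hauptmodul \<mu> J
    using assms(1,4) by unfold_locales
  define s where "s = (of_int w * of_nat (r + 1) / of_nat (disc_weight \<mu>) :: complex)"
  define g where "g z = 2 * of_real pi * \<i> / of_real (hecke_width \<mu>) *
      (of_nat (disc_weight \<mu>) * (of_nat \<mu> - 2) / (4 * of_nat \<mu>)) * E2 z" for z
  obtain L where L: "\<And>z. z \<in> upper_half_plane \<Longrightarrow> (L has_field_derivative g z) (at z)"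
    and disc: "\<And>z. z \<in> upper_half_plane \<Longrightarrow> hecke_discriminant \<mu> J z = exp (L z)"
    unfolding g_def using hecke_discriminant_eq[OF assms(3)] by blast
  have holL: "L holomorphic_on upper_half_plane"
    using L holomorphic_on_open[OF open_upper_half_plane] by blast
  have ex: "is_power_branch (hecke_discriminant \<mu> J) s (\<lambda>z. exp (s * L z))"
    unfolding is_power_branch_def using holL disc by blast
  have "disc_weight \<mu> \<noteq> 0" using mu by (simp add: disc_weight_def)
  have wronskian: "(serre_wronskian \<mu> E2 w r Y has_field_derivative
      s * g z * serre_wronskian \<mu> E2 w r Y z) (at z)" if z: "z \<in> upper_half_plane" for z
  proof -
    \<comment> \<open>The exponent s is the quotient of the weights w (r + 1) of the Wronskian and
      \<open>disc_weight\<close> of the discriminant, so \<open>disc_weight\<close> cancels.\<close>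
    have eq: "2 * of_real pi * \<i> / of_real (hecke_width \<mu>) *
        (of_int w * of_nat (r + 1) * (of_nat \<mu> - 2) / (4 * of_nat \<mu>)) * E2 z = s * g z"
      using \<open>disc_weight \<mu> \<noteq> 0\<close> by (simp add: s_def g_def)
    have "E2 holomorphic_on upper_half_plane"
      using assms(3) by (simp add: is_hecke_E2_def)
    moreover have "Y i \<in> hecke_solutions \<mu> E2 w r B" if "i \<le> r" for i
      using assms(6) that by (simp add: fundamental_solution_vector_def)
    ultimately show ?thesis
      unfolding eq[symmetric] by (intro has_field_derivative_serre_wronskian mu z)
  qed
  have nz: "serre_wronskian \<mu> E2 w r Y \<i> \<noteq> 0"
  proof (rule serre_wronskian_nonzero[OF mu _ _ assms(6) ii_in_upper_half_plane])
    show "E2 holomorphic_on upper_half_plane"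
      using assms(3) by (simp add: is_hecke_E2_def)
    show "B (2 * j) holomorphic_on upper_half_plane" if "2 \<le> j" "j \<le> r + 1" for j
      using assms(5)[OF that] by (simp add: automorphic_forms_def)
  qed
  have "\<exists>c. c \<noteq> 0 \<and> (\<forall>z\<in>upper_half_plane. serre_wronskian \<mu> E2 w r Y z = c * P z)"
    if P: "is_power_branch (hecke_discriminant \<mu> J) s P" for P
  proof -
    obtain K where K: "K holomorphic_on upper_half_plane"
        "\<And>z. z \<in> upper_half_plane \<Longrightarrow> exp (L z) = exp (K z)"
        "\<And>z. z \<in> upper_half_plane \<Longrightarrow> P z = exp (s * K z)"
      using P disc unfolding is_power_branch_def by metis
    have dK: "(K has_field_derivative g z) (at z)" if z: "z \<in> upper_half_plane" for z
    proof -
      have "(K has_field_derivative deriv K z) (at z)"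
        using K(1) open_upper_half_plane z by (rule holomorphic_derivI)
      then have "((\<lambda>z. exp (K z)) has_field_derivative exp (K z) * deriv K z) (at z)"
        by (auto intro!: derivative_eq_intros)
      moreover have "((\<lambda>z. exp (L z)) has_field_derivative exp (L z) * g z) (at z)"
        using L[OF z] by (auto intro!: derivative_eq_intros)
      then have "((\<lambda>z. exp (K z)) has_field_derivative exp (L z) * g z) (at z)"
        using open_upper_half_plane z K(2) by (rule has_field_derivative_transform_within_open)
      ultimately have "exp (K z) * deriv K z = exp (L z) * g z" by (rule DERIV_unique)
      then have "deriv K z = g z" using K(2)[OF z] by simp
      with \<open>(K has_field_derivative deriv K z) (at z)\<close> show ?thesis by simp
    qed
    have "((\<lambda>z. s * K z) has_field_derivative s * g z) (at z)" if "z \<in> upper_half_plane" for z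
      using dK[OF that] by (rule DERIV_cmult)
    from eq_const_mult_of_log_deriv[OF wronskian this] obtain c
      where c: "\<And>z. z \<in> upper_half_plane \<Longrightarrow> serre_wronskian \<mu> E2 w r Y z = c * exp (s * K z)"
      by blast
    have "c \<noteq> 0" using c[OF ii_in_upper_half_plane] nz by auto
    with c K(3) show ?thesis by auto
  qed
  with ex show ?thesis unfolding s_def by blast
qed

end
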